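(* Let $G=\mathrm{PSL}(2,\mathbb C)$ and let $P\subset G$ be the image of the group of upper triangular matrices with $1$ on the diagonal. The homomorphism $$\Psi\colon \bar B_3(G,P)\to\widehat{\mathcal P}(\mathbb C),\qquad \alpha\mapsto (w_0(\alpha),w_1(\alpha),w_2(\alpha))$$ (defined on generators $\alpha$, where $(w_0(\alpha),w_1(\alpha),w_2(\alpha))$ is the flattening defined in the context) sends boundaries to $0$ and cycles to $\widehat{\mathcal B}(\mathbb C)$, and therefore induces a homomorphism $$\Psi\colon H_3(G,P)\to\widehat{\mathcal B}(\mathbb C).$$
   Context: Truncated complex. For $n\ge 1$, a truncated $n$-simplex has vertices indexed by ordered pairs $ij$ of distinct elements of $\{0,\dots,n\}$. $\bar C_n(G,P)$, $n\ge1$, is the free abelian group on labelings $\{g^{ij}\}$ of these vertices by elements of $G$ such that (i) for fixed $i$ the elements $g^{ij}$ ($j\ne i$) are pairwise distinct and lie in the same left $P$-coset; (ii) each $g_{ij}:=(g^{ij})^{-1}g^{ji}$ is counter diagonal, i.e. of the form $\begin{pmatrix}0 & -a^{-1} \\ a & 0\end{pmatrix}$. $G$ acts by left multiplication. The boundary map is $\partial=\sum_k(-1)^kd_k$, where $d_k$ discards all labels whose index pair contains $k$ and renumbers the remaining indices in an order preserving way. $\bar B_*(G,P)=\bar C_*(G,P)\otimes_{\mathbb Z[G]}\mathbb Z$; its homology is canonically the relative homology $H_*(G,P)$ (the homology of the pair $(BG,BP)$, with $G$ and $P$ discrete). The elements $g_{ij}$ depend only on the generator of $\bar B_n(G,P)$.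 Extended Bloch group. Fix a branch $\mathrm{Log}$ of the logarithm on $\mathbb C\setminus\{0\}$. The cross-ratio of an ideal simplex with ordered distinct vertices $z_0,\dots,z_3\in\mathbb C\cup\{\infty\}$ is $z=\frac{(z_0-z_3)(z_1-z_2)}{(z_0-z_2)(z_1-z_3)}$. A flattening of it is a triple $(w_0,w_1,w_2)=(\mathrm{Log}\,z+p\pi i,\,-\mathrm{Log}(1-z)+q\pi i,\,-w_0-w_1)$ with $p,q\in\mathbb Z$, also written $[z;p,q]$. The log-parameter of the edges joining vertices $0,1$ and $2,3$ is $w_0$; of the edges $1,2$ and $0,3$ it is $w_1$; of the edges $0,2$ and $1,3$ it is $w_2$. Given five distinct points $z_0,\dots,z_4$ and flattenings $(w^i_0,w^i_1,w^i_2)$ of the simplices $\Delta_i=[z_0,\dots,\hat z_i,\dots,z_4]$, the flattening condition says that for every edge $[z_jz_k]$ the sum of $(-1)^i$ times the log-parameter of that edge in $\Delta_i$, over the three $\Delta_i$ containing it, is zero. $\widehat{\mathcal P}(\mathbb C)$ is the free abelian group on flattenings (flattened ideal simplices up to congruence) modulo: (i) $\sum_{i=0}^4(-1)^i(w^i_0,w^i_1,w^i_2)=0$ whenever the flattening condition holds; (ii) $[z;p,q]+[z;p',q']=[z;p,q']+[z;p',q]$. $\widehat{\mathcal B}(\mathbb C)$ is the kernel of $\widehat\nu\colon\widehat{\mathcal P}(\mathbb C)\to\wedge^2_{\mathbb Z}(\mathbb C)$, $(w_0,w_1,w_2)\mapsto w_0\wedge w_1$. The flattening of a generator. Let $\alpha\in\bar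 B_3(G,P)$ be a generator, represented by $\{g^{ij}\}$. The lower left entry $c(g_{ij})$ of $g_{ij}$ is nonzero and defined up to sign; choose the sign so that $c(g_{ij})=\exp(\tfrac12\mathrm{Log}(c(g_{ij})^2))$, so $c(g_{ij})=c(g_{ji})$. Put $$w_0(\alpha)=\mathrm{Log}\,c(g_{03})+\mathrm{Log}\,c(g_{12})-\mathrm{Log}\,c(g_{02})-\mathrm{Log}\,c(g_{13}),$$ $$w_1(\alpha)=\mathrm{Log}\,c(g_{02})+\mathrm{Log}\,c(g_{13})-\mathrm{Log}\,c(g_{01})-\mathrm{Log}\,c(g_{23}),$$ $$w_2(\alpha)=\mathrm{Log}\,c(g_{01})+\mathrm{Log}\,c(g_{23})-\mathrm{Log}\,c(g_{03})-\mathrm{Log}\,c(g_{12}).$$ This is a flattening of the ideal simplex with vertices $v_i=g^{ij}\infty$ (independent of $j$, and well defined up to congruence). *)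

theory Defs
  imports
    "HOL-Analysis.Analysis"
    "HOL-Algebra.Free_Abelian_Groups"
    "HOL-Algebra.Generated_Groups"
begin

section \<open>The groups \<open>G = PSL(2,\<complex>)\<close> and \<open>P\<close>\<close>

definition SL2C :: "(complex^2^2) monoid" where
  "SL2C = \<lparr>carrier = {A. det A = 1}, mult = (**), one = mat 1\<rparr>"

definition PSL2C :: "(complex^2^2) set monoid" where
  "PSL2C = SL2C Mod {mat 1, - mat 1}"

definition proj_class :: "complex^2^2 \<Rightarrow> (complex^2^2) set" where
  "proj_class A = {mat 1, - mat 1} #>\<^bsub>SL2C\<^esub> A"

definition mat2 :: "complex \<Rightarrow> complex \<Rightarrow> complex \<Rightarrow> complex \<Rightarrow> complex^2^2" where
  "mat2 a b c d = vector [vector [a, b], vector [c, d]]"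

definition parabolic_subgroup :: "(complex^2^2) set set" where
  "parabolic_subgroup = {proj_class (mat2 1 b 0 1) | b. True}"

definition counter_diagonal :: "(complex^2^2) set \<Rightarrow> bool" where
  "counter_diagonal X \<longleftrightarrow> (\<exists>a. a \<noteq> 0 \<and> X = proj_class (mat2 0 (- inverse a) a 0))"


section \<open>Truncated simplices and the complex \<open>B\<^sub>*(G,P)\<close>\<close>

type_synonym labeling = "nat \<times> nat \<Rightarrow> (complex^2^2) set"

definition trunc_vertices :: "nat \<Rightarrow> (nat \<times> nat) set" where
  "trunc_vertices n = {(i, j). i \<le> n \<and> j \<le> n \<and> i \<noteq> j}"

text \<open>The label of the vertex \<open>ij\<close>, written $g^{ij}$ in the literature, is \<open>\<sigma> (i, j)\<close>.
  The element $g_{ij} = (g^{ij})^{-1} g^{ji}$ is the following.\<close>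

definition edge_elt :: "labeling \<Rightarrow> nat \<Rightarrow> nat \<Rightarrow> (complex^2^2) set" where
  "edge_elt \<sigma> i j = inv\<^bsub>PSL2C\<^esub> (\<sigma> (i, j)) \<otimes>\<^bsub>PSL2C\<^esub> \<sigma> (j, i)"

definition trunc_simplices :: "nat \<Rightarrow> labeling set" where
  "trunc_simplices n =
    {\<sigma> \<in> trunc_vertices n \<rightarrow>\<^sub>E carrier PSL2C.
      (\<forall>i j k. (i, j) \<in> trunc_vertices n \<and> (i, k) \<in> trunc_vertices n \<and> j \<noteq> k \<longrightarrow>
         \<sigma> (i, j) \<noteq> \<sigma> (i, k) \<and>
         \<sigma> (i, j) <#\<^bsub>PSL2C\<^esub> parabolic_subgroup = \<sigma> (i, k) <#\<^bsub>PSL2C\<^esub> parabolic_subgroup) \<and>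
      (\<forall>(i, j) \<in> trunc_vertices n. counter_diagonal (edge_elt \<sigma> i j))}"

definition trunc_chains :: "nat \<Rightarrow> (labeling \<Rightarrow>\<^sub>0 int) monoid" where
  "trunc_chains n = free_Abelian_group (trunc_simplices n)"

definition act :: "nat \<Rightarrow> (complex^2^2) set \<Rightarrow> labeling \<Rightarrow> labeling" where
  "act n g \<sigma> = restrict (\<lambda>v. g \<otimes>\<^bsub>PSL2C\<^esub> \<sigma> v) (trunc_vertices n)"

text \<open>The order preserving injection of indices whose image omits \<open>k\<close>.\<close>

definition skip :: "nat \<Rightarrow> nat \<Rightarrow> nat" where
  "skip k i = (if i < k then i else Suc i)"

definition trunc_face :: "nat \<Rightarrow> nat \<Rightarrow> labeling \<Rightarrow> labeling" where
  "trunc_face n k \<sigma> = restrict (\<lambda>(i, j). \<sigma> (skip k i, skip k j)) (trunc_vertices (n - 1))"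

definition trunc_boundary :: "nat \<Rightarrow> (labeling \<Rightarrow>\<^sub>0 int) \<Rightarrow> (labeling \<Rightarrow>\<^sub>0 int)" where
  "trunc_boundary n =
     frag_extend (\<lambda>\<sigma>. \<Sum>k\<le>n. frag_cmul ((-1) ^ k) (frag_of (trunc_face n k \<sigma>)))"

text \<open>Tensoring a \<open>\<int>[G]\<close>-module \<open>C\<close> with the trivial module \<open>\<int>\<close> is the same as dividing out the
  subgroup generated by all \<open>g x - x\<close>; for a module freely generated as an abelian group by a
  \<open>G\<close>-set it suffices to let \<open>x\<close> range over that set.\<close>

definition coinv_rels :: "nat \<Rightarrow> (labeling \<Rightarrow>\<^sub>0 int) set" where
  "coinv_rels n = generate (trunc_chains n)
     {frag_of (act n g \<sigma>) - frag_of \<sigma> | g \<sigma>. g \<in> carrier PSL2C \<and> \<sigma> \<in> trunc_simplices n}"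

definition Bbar :: "nat \<Rightarrow> (labeling \<Rightarrow>\<^sub>0 int) set monoid" where
  "Bbar n = trunc_chains n Mod coinv_rels n"

definition Bbar_class :: "nat \<Rightarrow> (labeling \<Rightarrow>\<^sub>0 int) \<Rightarrow> (labeling \<Rightarrow>\<^sub>0 int) set" where
  "Bbar_class n x = coinv_rels n #>\<^bsub>trunc_chains n\<^esub> x"

text \<open>The map on a quotient group \<open>A Mod N\<close> induced by a map on \<open>A\<close> which is constant on the cosets
  of \<open>N\<close>.\<close>

definition induced :: "('a \<Rightarrow> 'b) \<Rightarrow> 'a set \<Rightarrow> 'b" where
  "induced f X = the_elem (f ` X)"

definition Bbar_boundary ::
  "nat \<Rightarrow> (labeling \<Rightarrow>\<^sub>0 int) set \<Rightarrow> (labeling \<Rightarrow>\<^sub>0 int) set" where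
  "Bbar_boundary n = induced (\<lambda>x. Bbar_class (n - 1) (trunc_boundary n x))"

text \<open>The complex lives in degrees \<open>\<ge> 1\<close>, so the following three notions are meant for \<open>n \<ge> 2\<close>.\<close>

definition Bbar_cycles :: "nat \<Rightarrow> (labeling \<Rightarrow>\<^sub>0 int) set set" where
  "Bbar_cycles n = kernel (Bbar n) (Bbar (n - 1)) (Bbar_boundary n)"

definition Bbar_boundaries :: "nat \<Rightarrow> (labeling \<Rightarrow>\<^sub>0 int) set set" where
  "Bbar_boundaries n = Bbar_boundary (Suc n) ` carrier (Bbar (Suc n))"

definition rel_homology :: "nat \<Rightarrow> (labeling \<Rightarrow>\<^sub>0 int) set set monoid" where
  "rel_homology n = (Bbar n)\<lparr>carrier := Bbar_cycles n\<rparr> Mod Bbar_boundaries n"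

definition homology_class ::
  "nat \<Rightarrow> (labeling \<Rightarrow>\<^sub>0 int) set \<Rightarrow> (labeling \<Rightarrow>\<^sub>0 int) set set" where
  "homology_class n x = Bbar_boundaries n #>\<^bsub>(Bbar n)\<lparr>carrier := Bbar_cycles n\<rparr>\<^esub> x"


section \<open>Ideal simplices and flattenings\<close>

text \<open>Any section of \<open>exp\<close> over \<open>\<complex> - {0}\<close>; there is no continuous one.\<close>

definition log_branch :: "(complex \<Rightarrow> complex) \<Rightarrow> bool" where
  "log_branch Log \<longleftrightarrow> (\<forall>z. z \<noteq> 0 \<longrightarrow> exp (Log z) = z)"

text \<open>\<open>\<complex> \<union> {\<infinity>}\<close>, with \<open>None\<close> as \<open>\<infinity>\<close>.\<close>

type_synonym ecomplex = "complex option"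

text \<open>In a cross-ratio of distinct points, \<open>\<infinity>\<close> occurs in at most one factor of the numerator and
  one of the denominator, on the same side of the difference; the limiting value is
  obtained by dropping these two factors.\<close>

fun ediff :: "ecomplex \<Rightarrow> ecomplex \<Rightarrow> complex" where
  "ediff (Some x) (Some y) = x - y"
| "ediff None _ = 1"
| "ediff _ None = 1"

text \<open>An ordered quadruple of ideal vertices is given by a function on \<open>{0..3}\<close>.\<close>

definition cross_ratio :: "(nat \<Rightarrow> ecomplex) \<Rightarrow> complex" where
  "cross_ratio v =
     (ediff (v 0) (v 3) * ediff (v 1) (v 2)) / (ediff (v 0) (v 2) * ediff (v 1) (v 3))"

type_synonym flattening = "complex \<times> complex \<times> complex"

text \<open>The flattening \<open>[z; p, q]\<close>. The triple determines \<open>z\<close>, \<open>p\<close> and \<open>q\<close> when \<open>z \<noteq> 0, 1\<close>, since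
  \<open>e^w\<^sub>0 = \<plusminus>z\<close> and \<open>e^(-w\<^sub>1) = \<plusminus>(1 - z)\<close>.\<close>

definition flat :: "(complex \<Rightarrow> complex) \<Rightarrow> complex \<Rightarrow> int \<Rightarrow> int \<Rightarrow> flattening" where
  "flat Log z p q =
     (let w0 = Log z + of_int p * of_real pi * \<i>;
          w1 = - Log (1 - z) + of_int q * of_real pi * \<i>
      in (w0, w1, - w0 - w1))"

definition flattenings :: "(complex \<Rightarrow> complex) \<Rightarrow> flattening set" where
  "flattenings Log = {flat Log z p q | z p q. z \<noteq> 0 \<and> z \<noteq> 1}"

definition is_flattening ::
  "(complex \<Rightarrow> complex) \<Rightarrow> (nat \<Rightarrow> ecomplex) \<Rightarrow> flattening \<Rightarrow> bool" where
  "is_flattening Log v w \<longleftrightarrow> inj_on v {0..3} \<and> (\<exists>p q. w = flat Log (cross_ratio v) p q)"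

definition log_param :: "flattening \<Rightarrow> nat set \<Rightarrow> complex" where
  "log_param w e =
     (case w of (w0, w1, w2) \<Rightarrow>
        if e = {0, 1} \<or> e = {2, 3} then w0
        else if e = {1, 2} \<or> e = {0, 3} then w1
        else w2)"

text \<open>The vertex \<open>j \<noteq> i\<close> of \<open>[z\<^sub>0,\<dots>,z\<^sub>4]\<close> has position \<open>unskip i j\<close> in the simplex obtained by
  omitting \<open>z\<^sub>i\<close>.\<close>

definition unskip :: "nat \<Rightarrow> nat \<Rightarrow> nat" where
  "unskip i j = (if j < i then j else j - 1)"

definition flattening_condition :: "(nat \<Rightarrow> flattening) \<Rightarrow> bool" where
  "flattening_condition w \<longleftrightarrow>
     (\<forall>j k. j < k \<and> k \<le> 4 \<longrightarrow>
        (\<Sum>i\<in>{0..4} - {j, k}. (-1) ^ i * log_param (w i) {unskip i j, unskip i k}) = 0)"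


section \<open>The extended pre-Bloch group and the extended Bloch group\<close>

definition five_term_rels :: "(complex \<Rightarrow> complex) \<Rightarrow> (flattening \<Rightarrow>\<^sub>0 int) set" where
  "five_term_rels Log =
     {\<Sum>i\<in>{0..4}. frag_cmul ((-1) ^ i) (frag_of (w i)) | z w.
        inj_on z {0..4} \<and>
        (\<forall>i\<le>4. is_flattening Log (\<lambda>m. z (skip i m)) (w i)) \<and>
        flattening_condition w}"

definition transfer_rels :: "(complex \<Rightarrow> complex) \<Rightarrow> (flattening \<Rightarrow>\<^sub>0 int) set" where
  "transfer_rels Log =
     {frag_of (flat Log z p q) + frag_of (flat Log z p' q')
       - frag_of (flat Log z p q') - frag_of (flat Log z p' q) | z p q p' q'. z \<noteq> 0 \<and> z \<noteq> 1}"

definition Phat_rels :: "(complex \<Rightarrow> complex) \<Rightarrow> (flattening \<Rightarrow>\<^sub>0 int) set" where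
  "Phat_rels Log = generate (free_Abelian_group (flattenings Log))
     (five_term_rels Log \<union> transfer_rels Log)"

definition Phat :: "(complex \<Rightarrow> complex) \<Rightarrow> (flattening \<Rightarrow>\<^sub>0 int) set monoid" where
  "Phat Log = free_Abelian_group (flattenings Log) Mod Phat_rels Log"

definition Phat_class ::
  "(complex \<Rightarrow> complex) \<Rightarrow> flattening \<Rightarrow> (flattening \<Rightarrow>\<^sub>0 int) set" where
  "Phat_class Log w = Phat_rels Log #>\<^bsub>free_Abelian_group (flattenings Log)\<^esub> frag_of w"

text \<open>The exterior square of \<open>\<complex>\<close> as an abelian group, by generators \<open>x \<and> y\<close> and relations.\<close>

definition wedge_rels :: "(complex \<times> complex \<Rightarrow>\<^sub>0 int) set" where
  "wedge_rels = generate (free_Abelian_group UNIV)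
     ({frag_of (x + y, z) - frag_of (x, z) - frag_of (y, z) | x y z. True} \<union>
      {frag_of (x, y + z) - frag_of (x, y) - frag_of (x, z) | x y z. True} \<union>
      {frag_of (x, x) | x. True})"

definition Wedge2C :: "(complex \<times> complex \<Rightarrow>\<^sub>0 int) set monoid" where
  "Wedge2C = free_Abelian_group UNIV Mod wedge_rels"

definition nu_free :: "(flattening \<Rightarrow>\<^sub>0 int) \<Rightarrow> (complex \<times> complex \<Rightarrow>\<^sub>0 int) set" where
  "nu_free x = wedge_rels #>\<^bsub>free_Abelian_group UNIV\<^esub>
     frag_extend (\<lambda>(w0, w1, w2). frag_of (w0, w1)) x"

text \<open>\<open>nu_free\<close> kills \<open>transfer_rels\<close> because \<open>\<pi>\<i> \<and> \<pi>\<i> = 0\<close>. It kills \<open>five_term_rels\<close> because the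
  flattening condition expresses five of the ten parameters \<open>w\<^sub>0\<close>, \<open>w\<^sub>1\<close> of the five simplices as
  integer linear combinations of the other five, and then the alternating sum of the \<open>w\<^sub>0 \<and> w\<^sub>1\<close>
  cancels identically.\<close>

definition nu_hat :: "(flattening \<Rightarrow>\<^sub>0 int) set \<Rightarrow> (complex \<times> complex \<Rightarrow>\<^sub>0 int) set" where
  "nu_hat = induced nu_free"

definition Bhat :: "(complex \<Rightarrow> complex) \<Rightarrow> (flattening \<Rightarrow>\<^sub>0 int) set monoid" where
  "Bhat Log = (Phat Log)\<lparr>carrier := kernel (Phat Log) Wedge2C nu_hat\<rparr>"


section \<open>The flattening of a generator\<close>

text \<open>An element of \<open>PSL(2,\<complex>)\<close> is a set \<open>{A, -A}\<close>, so its lower left entry is defined up to sign.\<close>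

definition low_left :: "(complex \<Rightarrow> complex) \<Rightarrow> (complex^2^2) set \<Rightarrow> complex" where
  "low_left Log X = (THE c. c \<in> (\<lambda>A. A $ 2 $ 1) ` X \<and> c = exp (Log (c\<^sup>2) / 2))"

definition apply_infinity :: "(complex^2^2) set \<Rightarrow> ecomplex" where
  "apply_infinity =
     induced (\<lambda>A. if A $ 2 $ 1 = 0 then None else Some (A $ 1 $ 1 / A $ 2 $ 1))"

definition gen_flattening :: "(complex \<Rightarrow> complex) \<Rightarrow> labeling \<Rightarrow> flattening" where
  "gen_flattening Log \<sigma> =
     (let l = (\<lambda>i j. Log (low_left Log (edge_elt \<sigma> i j)))
      in (l 0 3 + l 1 2 - l 0 2 - l 1 3,
          l 0 2 + l 1 3 - l 0 1 - l 2 3,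
          l 0 1 + l 2 3 - l 0 3 - l 1 2))"

end

theory Submission
  imports Defs
begin

text \<open>
  The labels \<open>\<sigma> (i, j)\<close> with fixed \<open>i\<close> have, up to sign, the same first column \<open>(a\<^sub>i, c\<^sub>i)\<close>. Hence
  \<open>v\<^sub>i = a\<^sub>i / c\<^sub>i\<close>, and the lower left entry of \<open>g\<^sub>i\<^sub>j\<close> is \<open>\<plusminus>(a\<^sub>i c\<^sub>j - a\<^sub>j c\<^sub>i)\<close>. These minors express the
  cross-ratio \<open>z\<close>, and \<open>1 - z\<close> by the Pluecker relation, so that \<open>w\<^sub>0\<close> and \<open>w\<^sub>1\<close> are logarithms of
  \<open>\<plusminus>z\<close> and \<open>\<plusminus>(1 - z)\<^bsup>-1\<^esup>\<close>. For a truncated 4-simplex each flattening condition is a formal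
  cancellation of logarithms \<open>l\<^sub>i\<^sub>j\<close> of these entries, so boundaries are five term relations.
  Finally \<open>w\<^sub>0 \<and> w\<^sub>1\<close> is, up to sign, the value of
  \<open>\<mu> = l\<^sub>0\<^sub>1 \<and> l\<^sub>1\<^sub>2 + l\<^sub>1\<^sub>2 \<and> l\<^sub>0\<^sub>2 + l\<^sub>0\<^sub>2 \<and> l\<^sub>0\<^sub>1\<close> on the boundary of the simplex, and therefore vanishes on
  cycles.
\<close>

section \<open>Quotients of free abelian groups\<close>

text \<open>As \<open>f\<close> kills \<open>N\<close>, every element \<open>n x\<close> of the
  coset has the value \<open>f x\<close>, so the image is a singleton and \<open>the_elem\<close>
  returns its element.\<close>

lemma induced_r_coset:
  assumes "group H" "f \<in> hom G H" "N \<subseteq> carrier G" "N \<noteq> {}" "\<And>n. n \<in> N \<Longrightarrow> f n = \<one>\<^bsub>H\<^esub>"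
    "x \<in> carrier G"
  shows "induced f (N #>\<^bsub>G\<^esub> x) = f x"
proof -
  interpret H: group H by fact
  have "f (n \<otimes>\<^bsub>G\<^esub> x) = f x" if "n \<in> N" for n
  proof -
    have "f (n \<otimes>\<^bsub>G\<^esub> x) = f n \<otimes>\<^bsub>H\<^esub> f x"
      using hom_mult assms that by (metis subsetD)
    then show ?thesis
      using assms that by (simp add: hom_in_carrier)
  qed
  then have "f ` (N #>\<^bsub>G\<^esub> x) = {f x}"
    using \<open>N \<noteq> {}\<close> by (auto simp: r_coset_def UNION_singleton_eq_range image_image)
  then show ?thesis
    by (simp add: induced_def)
qed

text \<open>\<open>K\<close> need not contain \<open>N\<close>. So for the homology group one needs \<open>\<Psi> \<partial> = 0\<close>, but not
  \<open>\<partial> \<partial> = 0\<close>.\<close>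

lemma induced_hom:
  assumes G: "group G" and H: "group H" and f: "f \<in> hom G H"
    and N: "N \<subseteq> carrier G" "N \<noteq> {}" "\<And>n. n \<in> N \<Longrightarrow> f n = \<one>\<^bsub>H\<^esub>"
    and K: "K \<subseteq> carrier G" "f ` K \<subseteq> C"
  shows "induced f \<in> hom (G\<lparr>carrier := K\<rparr> Mod N) (H\<lparr>carrier := C\<rparr>)"
proof -
  interpret G: group G by fact
  interpret H: group H by fact
  have coset: "N #>\<^bsub>G\<lparr>carrier := K\<rparr>\<^esub> x = N #>\<^bsub>G\<^esub> x" for x
    by (simp add: r_coset_def)
  have mult: "f (n \<otimes>\<^bsub>G\<^esub> x) = f x" if "n \<in> N" "x \<in> carrier G" for n x
  proof -
    have "f (n \<otimes>\<^bsub>G\<^esub> x) = f n \<otimes>\<^bsub>H\<^esub> f x"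
      using hom_mult f N that by (metis subsetD)
    then show ?thesis
      using N f that by (simp add: hom_in_carrier)
  qed
  have val: "induced f (N #>\<^bsub>G\<^esub> x) = f x" if "x \<in> carrier G" for x
    using induced_r_coset[OF H f N that] .
  \<comment> \<open>\<open>N\<close> is merely a nonempty set of elements killed by
    \<open>f\<close>, so the product of two cosets is evaluated element by element.\<close>
  have "induced f ((N #>\<^bsub>G\<^esub> x) <#>\<^bsub>G\<^esub> (N #>\<^bsub>G\<^esub> y)) = f x \<otimes>\<^bsub>H\<^esub> f y"
    if xy: "x \<in> carrier G" "y \<in> carrier G" for x y
  proof -
    have "f ((n \<otimes>\<^bsub>G\<^esub> x) \<otimes>\<^bsub>G\<^esub> (m \<otimes>\<^bsub>G\<^esub> y)) = f x \<otimes>\<^bsub>H\<^esub> f y" if "n \<in> N" "m \<in> N" for n m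
    proof -
      have "n \<otimes>\<^bsub>G\<^esub> x \<in> carrier G" "m \<otimes>\<^bsub>G\<^esub> y \<in> carrier G"
        using that xy N by auto
      then show ?thesis
        using hom_mult[OF f] mult that xy by metis
    qed
    then have "f ` ((N #>\<^bsub>G\<^esub> x) <#>\<^bsub>G\<^esub> (N #>\<^bsub>G\<^esub> y)) = {f x \<otimes>\<^bsub>H\<^esub> f y}"
      using \<open>N \<noteq> {}\<close> by (auto simp: r_coset_def set_mult_def image_iff)
    then show ?thesis
      by (simp add: induced_def)
  qed
  moreover have "(\<lambda>X Y. X <#>\<^bsub>G\<lparr>carrier := K\<rparr>\<^esub> Y) = (\<lambda>X Y. X <#>\<^bsub>G\<^esub> Y)"
    by (simp add: set_mult_def)
  ultimately show ?thesis
    using val K by (auto simp: hom_def carrier_FactGroup coset subset_iff fun_eq_iff)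
qed

lemma induced_hom_Mod:
  assumes "group G" "group H" "f \<in> hom G H" "N \<subseteq> carrier G" "N \<noteq> {}"
    "\<And>n. n \<in> N \<Longrightarrow> f n = \<one>\<^bsub>H\<^esub>"
  shows "induced f \<in> hom (G Mod N) H"
  using induced_hom[OF assms subset_refl, of "carrier H"] hom_carrier[OF assms(3)] by simp

lemma r_coset_free_Abelian_group:
  "N #>\<^bsub>free_Abelian_group S\<^esub> x = (\<lambda>n. n + x) ` N"
  by (auto simp: r_coset_def)

lemma subgroup_free_Abelian_groupD:
  assumes "subgroup N (free_Abelian_group S)"
  shows "0 \<in> N" "x \<in> N \<Longrightarrow> y \<in> N \<Longrightarrow> x + y \<in> N" "x \<in> N \<Longrightarrow> - x \<in> N"
    "x \<in> N \<Longrightarrow> y \<in> N \<Longrightarrow> x - y \<in> N"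
proof -
  show zero: "0 \<in> N" and add: "\<And>x y. x \<in> N \<Longrightarrow> y \<in> N \<Longrightarrow> x + y \<in> N"
    using subgroup.one_closed[OF assms] subgroup.m_closed[OF assms] by auto
  show uminus: "- x \<in> N" if "x \<in> N" for x
  proof -
    have "Poly_Mapping.keys x \<subseteq> S"
      using subgroup.mem_carrier[OF assms that] by simp
    then show ?thesis
      using subgroup.m_inv_closed[OF assms that] by simp
  qed
  show "x \<in> N \<Longrightarrow> y \<in> N \<Longrightarrow> x - y \<in> N"
    using add[of x "- y"] uminus[of y] by simp
qed

lemma r_coset_eq_iff_free_Abelian_group:
  assumes "subgroup N (free_Abelian_group S)"
  shows "N #>\<^bsub>free_Abelian_group S\<^esub> x = N #>\<^bsub>free_Abelian_group S\<^esub> y \<longleftrightarrow> x - y \<in> N"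
proof
  note N = subgroup_free_Abelian_groupD[OF assms]
  show "x - y \<in> N"
    if "N #>\<^bsub>free_Abelian_group S\<^esub> x = N #>\<^bsub>free_Abelian_group S\<^esub> y"
  proof -
    have "0 + x \<in> (\<lambda>n. n + x) ` N"
      using N(1) by (rule imageI)
    then have "x \<in> (\<lambda>n. n + y) ` N"
      using that by (simp add: r_coset_free_Abelian_group)
    then show ?thesis
      by auto
  qed
  show "N #>\<^bsub>free_Abelian_group S\<^esub> x = N #>\<^bsub>free_Abelian_group S\<^esub> y" if d: "x - y \<in> N"
  proof -
    have "n + x \<in> (\<lambda>n. n + y) ` N" if "n \<in> N" for n
      by (rule image_eqI[of _ _ "n + (x - y)"]) (use N(2) d that in auto)
    moreover have "n + y \<in> (\<lambda>n. n + x) ` N" if "n \<in> N" for n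
      by (rule image_eqI[of _ _ "n - (x - y)"]) (use N(4) d that in auto)
    ultimately show ?thesis
      by (auto simp: r_coset_free_Abelian_group)
  qed
qed

lemma r_coset_eq_one_free_Abelian_group:
  assumes "subgroup N (free_Abelian_group S)"
  shows "N #>\<^bsub>free_Abelian_group S\<^esub> x = N \<longleftrightarrow> x \<in> N"
  using r_coset_eq_iff_free_Abelian_group[OF assms, of x 0]
  by (simp add: r_coset_free_Abelian_group)

lemma normal_free_Abelian_group:
  "subgroup N (free_Abelian_group S) \<Longrightarrow> N \<lhd> free_Abelian_group S"
  by (simp add: abelian_free_Abelian_group comm_group.normal_iff_subgroup)

lemma subgroup_generate_free_Abelian_group:
  "T \<subseteq> carrier (free_Abelian_group S) \<Longrightarrow>
    subgroup (generate (free_Abelian_group S) T) (free_Abelian_group S)"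
  by (simp add: group.generate_is_subgroup)

text \<open>Compatibility with relations is checked on generators through this: the preimage of a
  subgroup under an additive map is closed under the operations that build
  \<open>generate\<close>.\<close>

lemma generate_free_Abelian_group_image:
  assumes T: "T \<subseteq> carrier (free_Abelian_group S)" and x: "x \<in> generate (free_Abelian_group S) T"
    and M: "subgroup M (free_Abelian_group S')" and f: "Modules.additive f"
    and TM: "\<And>t. t \<in> T \<Longrightarrow> f t \<in> M"
  shows "f x \<in> M"
  using x
proof (induction rule: generate.induct)
  case one
  then show ?case
    using subgroup_free_Abelian_groupD(1)[OF M] by (simp add: Modules.additive.zero[OF f])
next
  case (incl h)
  then show ?case
    by (rule TM)
next
  case (inv h)
  then have "Poly_Mapping.keys h \<subseteq> S"
    using subsetD[OF T] by simp
  then show ?case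
    using subgroup_free_Abelian_groupD(3)[OF M TM[OF inv]] by (simp add: Modules.additive.minus[OF f])
next
  case (eng h1 h2)
  then show ?case
    using subgroup_free_Abelian_groupD(2)[OF M] by (simp add: Modules.additive.add[OF f])
qed

lemma additive_frag_extend: "Modules.additive (frag_extend f)"
  by (simp add: Modules.additive_def frag_extend_add)

text \<open>Reduces chain-level statements modulo a subgroup to single basis elements, since formal
  sums arise from these by differences.\<close>

lemma free_Abelian_group_image:
  assumes x: "x \<in> carrier (free_Abelian_group S)"
    and M: "subgroup M (free_Abelian_group S')" and f: "Modules.additive f"
    and SM: "\<And>s. s \<in> S \<Longrightarrow> f (frag_of s) \<in> M"
  shows "f x \<in> M"
proof -
  have "Poly_Mapping.keys x \<subseteq> S"
    using x by simp
  then show ?thesis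
    by (induction x rule: frag_induction)
      (use SM subgroup_free_Abelian_groupD[OF M] Modules.additive.zero[OF f] Modules.additive.diff[OF f] in auto)
qed

lemma frag_extend_in_free_Abelian_group:
  assumes "x \<in> carrier (free_Abelian_group S)"
    "\<And>s. s \<in> S \<Longrightarrow> f s \<in> carrier (free_Abelian_group S')"
  shows "frag_extend f x \<in> carrier (free_Abelian_group S')"
  using assms(1)
  by (rule free_Abelian_group_image[OF _ group.subgroup_self additive_frag_extend])
    (use assms(2) in auto)

lemma r_coset_additive_hom:
  assumes N: "subgroup N (free_Abelian_group S')" and f: "Modules.additive f"
    and fS: "\<And>x. x \<in> carrier (free_Abelian_group S) \<Longrightarrow> f x \<in> carrier (free_Abelian_group S')"
  shows "(\<lambda>x. N #>\<^bsub>free_Abelian_group S'\<^esub> f x)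
    \<in> hom (free_Abelian_group S) (free_Abelian_group S' Mod N)"
proof -
  have "f \<in> hom (free_Abelian_group S) (free_Abelian_group S')"
    using fS Modules.additive.add[OF f] by (intro homI) auto
  from hom_compose[OF this normal.r_coset_hom_Mod[OF normal_free_Abelian_group[OF N]]]
  show ?thesis
    by (simp add: comp_def)
qed

lemma group_free_Abelian_group_Mod:
  "subgroup N (free_Abelian_group S) \<Longrightarrow> group (free_Abelian_group S Mod N)"
  by (intro normal.factorgroup_is_group normal_free_Abelian_group)

lemma subgroup_alternating_sum:
  assumes N: "subgroup N (free_Abelian_group S)" and f: "\<And>k. k \<in> A \<Longrightarrow> f k \<in> N"
  shows "(\<Sum>k\<in>A. frag_cmul ((-1) ^ k) (f k)) \<in> N"
  using f
proof (induction A rule: infinite_finite_induct)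
  case (insert k A)
  have "frag_cmul ((-1) ^ k) (f k) \<in> N"
    using insert.prems[of k] subgroup_free_Abelian_groupD(3)[OF N] by (cases "even k") auto
  then show ?case
    using insert subgroup_free_Abelian_groupD(2)[OF N] by simp
qed (simp_all add: subgroup_free_Abelian_groupD(1)[OF N])


section \<open>The exterior square of \<open>\<complex>\<close>\<close>

lemma subgroup_wedge_rels: "subgroup wedge_rels (free_Abelian_group UNIV)"
  unfolding wedge_rels_def by (rule subgroup_generate_free_Abelian_group) (simp add: subset_iff)

lemma wedge_rels_generators:
  "frag_of (x + y, z) - frag_of (x, z) - frag_of (y, z) \<in> wedge_rels"
  "frag_of (x, y + z) - frag_of (x, y) - frag_of (x, z) \<in> wedge_rels"
  "frag_of (x, x) \<in> wedge_rels"
  unfolding wedge_rels_def by (rule generate.incl, blast)+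

text \<open>The same group as \<^const>\<open>Wedge2C\<close>, as a type, so that identities in it can be proved by
  rewriting in the class \<^class>\<open>ab_group_add\<close>.\<close>

quotient_type wedge2 = "complex \<times> complex \<Rightarrow>\<^sub>0 int" / "\<lambda>x y. x - y \<in> wedge_rels"
proof (rule equivpI)
  note N = subgroup_free_Abelian_groupD[OF subgroup_wedge_rels]
  show "reflp (\<lambda>x y. x - y \<in> wedge_rels)"
    by (simp add: reflp_def N(1))
  show "symp (\<lambda>x y. x - y \<in> wedge_rels)"
  proof (rule sympI)
    fix x y assume "x - y \<in> wedge_rels"
    from N(3)[OF this] show "y - x \<in> wedge_rels"
      by simp
  qed
  show "transp (\<lambda>x y. x - y \<in> wedge_rels)"
  proof (rule transpI)
    fix x y z assume "x - y \<in> wedge_rels" "y - z \<in> wedge_rels"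
    from N(2)[OF this] show "x - z \<in> wedge_rels"
      by simp
  qed
qed

instantiation wedge2 :: ab_group_add
begin

lift_definition zero_wedge2 :: wedge2 is 0 .

lift_definition plus_wedge2 :: "wedge2 \<Rightarrow> wedge2 \<Rightarrow> wedge2" is "(+)"
  using subgroup_free_Abelian_groupD(2)[OF subgroup_wedge_rels] by (simp add: add_diff_add)

lift_definition uminus_wedge2 :: "wedge2 \<Rightarrow> wedge2" is uminus
proof -
  fix x y :: "complex \<times> complex \<Rightarrow>\<^sub>0 int"
  assume "x - y \<in> wedge_rels"
  from subgroup_free_Abelian_groupD(3)[OF subgroup_wedge_rels this]
  show "- x - - y \<in> wedge_rels"
    by simp
qed

lift_definition minus_wedge2 :: "wedge2 \<Rightarrow> wedge2 \<Rightarrow> wedge2" is "(-)"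
proof -
  fix x x' y y' :: "complex \<times> complex \<Rightarrow>\<^sub>0 int"
  assume "x - x' \<in> wedge_rels" "y - y' \<in> wedge_rels"
  from subgroup_free_Abelian_groupD(4)[OF subgroup_wedge_rels this]
  show "x - y - (x' - y') \<in> wedge_rels"
    by (simp add: algebra_simps)
qed

instance
  by standard (transfer; simp add: subgroup_free_Abelian_groupD(1)[OF subgroup_wedge_rels])+

end

lemma abs_wedge2_eq_0_iff: "abs_wedge2 x = 0 \<longleftrightarrow> x \<in> wedge_rels"
  by (simp add: zero_wedge2_def wedge2.abs_eq_iff)

lemma additive_abs_wedge2: "Modules.additive abs_wedge2"
  by (simp add: Modules.additive_def plus_wedge2.abs_eq)

definition wedge :: "complex \<Rightarrow> complex \<Rightarrow> wedge2" where
  "wedge x y = abs_wedge2 (frag_of (x, y))"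

lemma wedge_add_left: "wedge (x + y) z = wedge x z + wedge y z"
  using wedge_rels_generators(1)[of x y z]
  unfolding wedge_def abs_wedge2_eq_0_iff[symmetric]
  by (simp add: Modules.additive.diff[OF additive_abs_wedge2] diff_diff_add right_minus_eq
      Modules.additive.add[OF additive_abs_wedge2] del: diff_diff_eq2)

lemma wedge_add_right: "wedge x (y + z) = wedge x y + wedge x z"
  using wedge_rels_generators(2)[of x y z]
  unfolding wedge_def abs_wedge2_eq_0_iff[symmetric]
  by (simp add: Modules.additive.diff[OF additive_abs_wedge2] diff_diff_add right_minus_eq
      Modules.additive.add[OF additive_abs_wedge2] del: diff_diff_eq2)

lemma wedge_self [simp]: "wedge x x = 0"
  using wedge_rels_generators(3) by (simp add: wedge_def abs_wedge2_eq_0_iff)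

lemma additive_wedge: "Modules.additive (\<lambda>x. wedge x y)" "Modules.additive (wedge x)"
  by (simp_all add: Modules.additive_def wedge_add_left wedge_add_right)

lemmas wedge_bilinear =
  wedge_add_left wedge_add_right
  Modules.additive.minus[OF additive_wedge(1)] Modules.additive.minus[OF additive_wedge(2)]
  Modules.additive.diff[OF additive_wedge(1)] Modules.additive.diff[OF additive_wedge(2)]

lemma wedge_swap: "wedge y x = - wedge x y"
proof -
  have "wedge y x + wedge x y = wedge (x + y) (x + y)"
    unfolding wedge_add_left wedge_add_right by simp
  then show ?thesis
    by (simp add: eq_neg_iff_add_eq_0)
qed

text \<open>Bilinearity reduces this to \<open>wedge t t = 0\<close>. With t = \<pi>i it is what
  removes the p and q contributions from the transfer relations.\<close>

lemma wedge_of_int_multiples [simp]: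
  "wedge (of_int p * t) (of_int q * t) = 0"
proof -
  have l: "wedge (of_int p * t) t = 0" for p
  proof (induction p rule: int_induct[of _ 0])
    case base
    then show ?case using Modules.additive.zero[OF additive_wedge(1)] by simp
  qed (simp_all add: wedge_bilinear distrib_right left_diff_distrib)
  show ?thesis
  proof (induction q rule: int_induct[of _ 0])
    case base
    then show ?case using Modules.additive.zero[OF additive_wedge(2)] by simp
  qed (simp_all add: wedge_bilinear distrib_right left_diff_distrib l)
qed


section \<open>The group \<open>PSL(2,\<complex>)\<close>\<close>

lemma mat2_nth [simp]:
  "mat2 a b c d $ 1 $ 1 = a" "mat2 a b c d $ 1 $ 2 = b"
  "mat2 a b c d $ 2 $ 1 = c" "mat2 a b c d $ 2 $ 2 = d"
  by (simp_all add: mat2_def)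

lemma matrix_mult_nth_2:
  fixes A B :: "complex^2^2"
  shows "(A ** B) $ i $ j = A $ i $ 1 * B $ 1 $ j + A $ i $ 2 * B $ 2 $ j"
  by (simp add: matrix_matrix_mult_def sum_2)

lemma mat_1_nth_2 [simp]:
  "(mat 1 :: complex^2^2) $ 1 $ 1 = 1" "(mat 1 :: complex^2^2) $ 1 $ 2 = 0"
  "(mat 1 :: complex^2^2) $ 2 $ 1 = 0" "(mat 1 :: complex^2^2) $ 2 $ 2 = 1"
  by (simp_all add: mat_def)

lemmas mat2_eqI = vec_eq_iff[of "_ :: complex^2^2"] vec_eq_iff[of "_ :: complex^2"] forall_2

lemma uminus_matrix_mult:
  fixes A B :: "complex^2^2"
  shows "(- A) ** B = - (A ** B)" "A ** (- B) = - (A ** B)"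
  by (simp_all add: mat2_eqI matrix_mult_nth_2)

lemma det_uminus_2: "det (- A) = det (A :: complex^2^2)"
  by (simp add: det_2)

text \<open>The adjugate, an explicit inverse for determinant 1; its entries make the lower left
  entry of \<open>edge_elt\<close> computable.\<close>

definition adj2 :: "complex^2^2 \<Rightarrow> complex^2^2" where
  "adj2 A = mat2 (A $ 2 $ 2) (- A $ 1 $ 2) (- A $ 2 $ 1) (A $ 1 $ 1)"

lemma det_adj2 [simp]: "det (adj2 A) = det A"
  by (simp add: adj2_def det_2)

lemma adj2_mult: "det A = 1 \<Longrightarrow> adj2 A ** A = mat 1"
  by (simp add: adj2_def det_2 mat2_eqI matrix_mult_nth_2 algebra_simps)

lemma SL2C_simps [simp]:
  "A \<in> carrier SL2C \<longleftrightarrow> det A = 1" "A \<otimes>\<^bsub>SL2C\<^esub> B = A ** B" "\<one>\<^bsub>SL2C\<^esub> = mat 1"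
  by (simp_all add: SL2C_def)

lemma group_SL2C: "group SL2C"
  by (rule groupI) (auto simp: det_mul matrix_mul_assoc intro!: exI[of _ "adj2 _"] adj2_mult)

lemma proj_class_eq: "proj_class A = {A, - A}"
  by (auto simp: proj_class_def r_coset_def uminus_matrix_mult)

lemma normal_center_SL2C: "{mat 1, - mat 1} \<lhd> SL2C"
proof -
  have "inv\<^bsub>SL2C\<^esub> (- mat 1) = - mat 1"
    by (rule group.inv_equality[OF group_SL2C]) (simp_all add: uminus_matrix_mult det_uminus_2)
  then have "subgroup {mat 1, - mat 1} SL2C"
    using monoid.inv_one[OF group.is_monoid[OF group_SL2C]]
    by (intro group.subgroupI[OF group_SL2C]) (auto simp: uminus_matrix_mult det_uminus_2)
  then show ?thesis
    by (intro group.normalI[OF group_SL2C])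
      (auto simp: r_coset_def l_coset_def uminus_matrix_mult)
qed

lemma group_PSL2C: "group PSL2C"
  unfolding PSL2C_def by (rule normal.factorgroup_is_group[OF normal_center_SL2C])

lemma carrier_PSL2C: "carrier PSL2C = proj_class ` {A. det A = 1}"
  by (auto simp: PSL2C_def carrier_FactGroup proj_class_def image_iff)

lemma one_PSL2C: "\<one>\<^bsub>PSL2C\<^esub> = proj_class (mat 1)"
  by (simp add: PSL2C_def proj_class_eq)

lemma proj_class_mult:
  "det A = 1 \<Longrightarrow> det B = 1 \<Longrightarrow> proj_class A \<otimes>\<^bsub>PSL2C\<^esub> proj_class B = proj_class (A ** B)"
  using normal.rcos_sum[OF normal_center_SL2C, of A B] by (simp add: PSL2C_def proj_class_def)

lemma proj_class_inv:
  assumes "det A = 1"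
  shows "inv\<^bsub>PSL2C\<^esub> (proj_class A) = proj_class (adj2 A)"
  by (rule group.inv_equality[OF group_PSL2C])
    (use assms in \<open>auto simp: proj_class_mult one_PSL2C carrier_PSL2C adj2_mult\<close>)

text \<open>The exponential squares to the square of the entry, hence is one of the two possible
  lower left entries. Both signs have the same square, so the condition in the \<open>THE\<close>
  selects exactly this one.\<close>

lemma low_left_proj_class:
  assumes "log_branch Log" "A $ 2 $ 1 \<noteq> 0"
  shows "low_left Log (proj_class A) = exp (Log ((A $ 2 $ 1)\<^sup>2) / 2)"
proof -
  let ?c = "A $ 2 $ 1" and ?e = "exp (Log ((A $ 2 $ 1)\<^sup>2) / 2)"
  have "?e\<^sup>2 = exp (Log (?c\<^sup>2))"
    by (simp add: power2_eq_square flip: exp_add)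
  also have "\<dots> = ?c\<^sup>2"
    using assms by (simp add: log_branch_def)
  finally have "?e = ?c \<or> ?e = - ?c"
    by (simp add: power2_eq_iff)
  then show ?thesis
    unfolding low_left_def proj_class_eq by (intro the_equality) (auto simp: power2_eq_square)
qed

lemma apply_infinity_proj_class:
  "apply_infinity (proj_class A) =
    (if A $ 2 $ 1 = 0 then None else Some (A $ 1 $ 1 / A $ 2 $ 1))"
  by (auto simp: apply_infinity_def induced_def proj_class_eq)


section \<open>Truncated simplices\<close>

lemma trunc_vertices_iff [simp]: "(i, j) \<in> trunc_vertices n \<longleftrightarrow> i \<le> n \<and> j \<le> n \<and> i \<noteq> j"
  by (simp add: trunc_vertices_def)

lemma trunc_simplicesD:
  assumes "\<sigma> \<in> trunc_simplices n"
  shows "\<sigma> \<in> extensional (trunc_vertices n)"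
    "i \<le> n \<Longrightarrow> j \<le> n \<Longrightarrow> i \<noteq> j \<Longrightarrow> \<sigma> (i, j) \<in> carrier PSL2C"
    "i \<le> n \<Longrightarrow> j \<le> n \<Longrightarrow> k \<le> n \<Longrightarrow> i \<noteq> j \<Longrightarrow> i \<noteq> k \<Longrightarrow> j \<noteq> k \<Longrightarrow> \<sigma> (i, j) \<noteq> \<sigma> (i, k)"
    "i \<le> n \<Longrightarrow> j \<le> n \<Longrightarrow> k \<le> n \<Longrightarrow> i \<noteq> j \<Longrightarrow> i \<noteq> k \<Longrightarrow> j \<noteq> k \<Longrightarrow>
      \<sigma> (i, j) <#\<^bsub>PSL2C\<^esub> parabolic_subgroup = \<sigma> (i, k) <#\<^bsub>PSL2C\<^esub> parabolic_subgroup"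
    "i \<le> n \<Longrightarrow> j \<le> n \<Longrightarrow> i \<noteq> j \<Longrightarrow> counter_diagonal (edge_elt \<sigma> i j)"
  using assms by (auto simp: trunc_simplices_def PiE_def Pi_def)

lemma trunc_simplicesI:
  assumes "\<sigma> \<in> extensional (trunc_vertices n)"
    "\<And>i j. i \<le> n \<Longrightarrow> j \<le> n \<Longrightarrow> i \<noteq> j \<Longrightarrow> \<sigma> (i, j) \<in> carrier PSL2C"
    "\<And>i j k. i \<le> n \<Longrightarrow> j \<le> n \<Longrightarrow> k \<le> n \<Longrightarrow> i \<noteq> j \<Longrightarrow> i \<noteq> k \<Longrightarrow> j \<noteq> k \<Longrightarrow>
      \<sigma> (i, j) \<noteq> \<sigma> (i, k)"
    "\<And>i j k. i \<le> n \<Longrightarrow> j \<le> n \<Longrightarrow> k \<le> n \<Longrightarrow> i \<noteq> j \<Longrightarrow> i \<noteq> k \<Longrightarrow> j \<noteq> k \<Longrightarrow>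
      \<sigma> (i, j) <#\<^bsub>PSL2C\<^esub> parabolic_subgroup = \<sigma> (i, k) <#\<^bsub>PSL2C\<^esub> parabolic_subgroup"
    "\<And>i j. i \<le> n \<Longrightarrow> j \<le> n \<Longrightarrow> i \<noteq> j \<Longrightarrow> counter_diagonal (edge_elt \<sigma> i j)"
  shows "\<sigma> \<in> trunc_simplices n"
  using assms by (auto simp: trunc_simplices_def PiE_def Pi_def)

section \<open>The action of G and the faces of truncated simplices\<close>

lemma act_apply: "i \<le> n \<Longrightarrow> j \<le> n \<Longrightarrow> i \<noteq> j \<Longrightarrow> act n g \<sigma> (i, j) = g \<otimes>\<^bsub>PSL2C\<^esub> \<sigma> (i, j)"
  by (simp add: act_def)

text \<open>In (g x)^(-1) (g y) the factor g cancels. Hence whatever is built from edge elements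
  descends to coinvariants.\<close>

lemma edge_elt_act:
  assumes "\<sigma> \<in> trunc_simplices n" "g \<in> carrier PSL2C" "i \<le> n" "j \<le> n" "i \<noteq> j"
  shows "edge_elt (act n g \<sigma>) i j = edge_elt \<sigma> i j"
proof -
  interpret PSL2C: group PSL2C by (rule group_PSL2C)
  have "\<sigma> (i, j) \<in> carrier PSL2C" "\<sigma> (j, i) \<in> carrier PSL2C"
    using assms trunc_simplicesD(2) by auto
  moreover from this have "inv\<^bsub>PSL2C\<^esub> g \<otimes>\<^bsub>PSL2C\<^esub> (g \<otimes>\<^bsub>PSL2C\<^esub> \<sigma> (j, i)) = \<sigma> (j, i)"
    using assms(2) by (simp flip: PSL2C.m_assoc)
  ultimately show ?thesis
    using assms by (simp add: edge_elt_def act_apply PSL2C.inv_mult_group PSL2C.m_assoc)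
qed

lemma act_in_trunc_simplices:
  assumes \<sigma>: "\<sigma> \<in> trunc_simplices n" and g: "g \<in> carrier PSL2C"
  shows "act n g \<sigma> \<in> trunc_simplices n"
proof (rule trunc_simplicesI)
  interpret PSL2C: group PSL2C by (rule group_PSL2C)
  note D = trunc_simplicesD[OF \<sigma>]
  show "act n g \<sigma> \<in> extensional (trunc_vertices n)"
    by (simp add: act_def)
  fix i j
  assume ij: "i \<le> n" "j \<le> n" "i \<noteq> j"
  show "act n g \<sigma> (i, j) \<in> carrier PSL2C"
    using ij D(2) g by (simp add: act_apply)
  show "counter_diagonal (edge_elt (act n g \<sigma>) i j)"
    using ij D(5) edge_elt_act[OF \<sigma> g] by simp
  fix k
  assume k: "k \<le> n" "i \<noteq> k" "j \<noteq> k"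
  show "act n g \<sigma> (i, j) \<noteq> act n g \<sigma> (i, k)"
    using D(2,3) ij k g by (simp add: act_apply)
  have "(g \<otimes>\<^bsub>PSL2C\<^esub> x) <#\<^bsub>PSL2C\<^esub> parabolic_subgroup =
      g <#\<^bsub>PSL2C\<^esub> (x <#\<^bsub>PSL2C\<^esub> parabolic_subgroup)" if "x \<in> carrier PSL2C" for x
    using g that
    by (intro PSL2C.lcos_m_assoc[symmetric])
      (auto simp: parabolic_subgroup_def carrier_PSL2C det_2)
  then show "act n g \<sigma> (i, j) <#\<^bsub>PSL2C\<^esub> parabolic_subgroup =
      act n g \<sigma> (i, k) <#\<^bsub>PSL2C\<^esub> parabolic_subgroup"
    using D(2)[of i j] D(2)[of i k] D(4)[of i j k] ij k by (simp add: act_apply)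
qed

lemma skip_le: "1 \<le> n \<Longrightarrow> i \<le> n - 1 \<Longrightarrow> skip k i \<le> n"
  by (auto simp: skip_def)

lemma skip_eq_iff [simp]: "skip k i = skip k j \<longleftrightarrow> i = j"
  by (auto simp: skip_def)

lemma trunc_face_apply:
  "i \<le> n - 1 \<Longrightarrow> j \<le> n - 1 \<Longrightarrow> i \<noteq> j \<Longrightarrow> trunc_face n k \<sigma> (i, j) = \<sigma> (skip k i, skip k j)"
  by (simp add: trunc_face_def)

lemma edge_elt_trunc_face:
  "i \<le> n - 1 \<Longrightarrow> j \<le> n - 1 \<Longrightarrow> i \<noteq> j \<Longrightarrow>
    edge_elt (trunc_face n k \<sigma>) i j = edge_elt \<sigma> (skip k i) (skip k j)"
  by (simp add: edge_elt_def trunc_face_apply)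

lemma trunc_face_in_trunc_simplices:
  assumes "1 \<le> n" and \<sigma>: "\<sigma> \<in> trunc_simplices n"
  shows "trunc_face n k \<sigma> \<in> trunc_simplices (n - 1)"
proof (rule trunc_simplicesI)
  note D = trunc_simplicesD[OF \<sigma>]
  note le = skip_le[OF \<open>1 \<le> n\<close>]
  show "trunc_face n k \<sigma> \<in> extensional (trunc_vertices (n - 1))"
    by (simp add: trunc_face_def)
  fix i j
  assume ij: "i \<le> n - 1" "j \<le> n - 1" "i \<noteq> j"
  show "trunc_face n k \<sigma> (i, j) \<in> carrier PSL2C"
    using ij D(2) le by (simp add: trunc_face_apply)
  show "counter_diagonal (edge_elt (trunc_face n k \<sigma>) i j)"
    using ij D(5) le by (simp add: edge_elt_trunc_face)
  fix l
  assume l: "l \<le> n - 1" "i \<noteq> l" "j \<noteq> l"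
  show "trunc_face n k \<sigma> (i, j) \<noteq> trunc_face n k \<sigma> (i, l)"
    using ij l D(3) le by (simp add: trunc_face_apply)
  show "trunc_face n k \<sigma> (i, j) <#\<^bsub>PSL2C\<^esub> parabolic_subgroup =
      trunc_face n k \<sigma> (i, l) <#\<^bsub>PSL2C\<^esub> parabolic_subgroup"
    using ij l D(4)[of "skip k i" "skip k j" "skip k l"] le by (simp add: trunc_face_apply)
qed

lemma trunc_face_act:
  assumes "1 \<le> n"
  shows "trunc_face n k (act n g \<sigma>) = act (n - 1) g (trunc_face n k \<sigma>)"
  using skip_le[OF assms] by (auto simp: trunc_face_def act_def restrict_def fun_eq_iff)

text \<open>Right multiplication by an upper unitriangular matrix fixes the first column. One label
  at \<open>i\<close> is lifted to a matrix, and its sign is carried along the left P-coset to all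
  other labels at \<open>i\<close>.\<close>

lemma trunc_simplex_columns:
  assumes \<sigma>: "\<sigma> \<in> trunc_simplices n"
  obtains a c where
    "\<And>i j. i \<le> n \<Longrightarrow> j \<le> n \<Longrightarrow> i \<noteq> j \<Longrightarrow>
      \<exists>A. det A = 1 \<and> \<sigma> (i, j) = proj_class A \<and> A $ 1 $ 1 = a i \<and> A $ 2 $ 1 = c i"
proof -
  note D = trunc_simplicesD[OF \<sigma>]
  have "\<exists>a c. \<forall>j. i \<le> n \<and> j \<le> n \<and> i \<noteq> j \<longrightarrow>
      (\<exists>A. det A = 1 \<and> \<sigma> (i, j) = proj_class A \<and> A $ 1 $ 1 = a \<and> A $ 2 $ 1 = c)" for i
  \<comment> \<open>Without a second index \<open>k\<close> there is no label at \<open>i\<close>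
    and the claim is vacuous.\<close>
  proof (cases "\<exists>k. i \<le> n \<and> k \<le> n \<and> i \<noteq> k")
    case True
    then obtain k where k: "i \<le> n" "k \<le> n" "i \<noteq> k"
      by blast
    then obtain A where A: "det A = 1" "\<sigma> (i, k) = proj_class A"
      using D(2)[of i k] by (auto simp: carrier_PSL2C)
    have "\<exists>B. det B = 1 \<and> \<sigma> (i, j) = proj_class B \<and> B $ 1 $ 1 = A $ 1 $ 1 \<and> B $ 2 $ 1 = A $ 2 $ 1"
      if j: "j \<le> n" "i \<noteq> j" for j
    proof (cases "j = k")
      case True
      then show ?thesis
        using A by blast
    next
      case False
      \<comment> \<open>P contains the identity, so \<open>\<sigma> (i, j)\<close> lies in its own
        coset and therefore in that of \<open>\<sigma> (i, k)\<close>.\<close>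
      have "mat2 1 0 0 1 = mat 1"
        by (simp add: mat2_eqI)
      then have "\<one>\<^bsub>PSL2C\<^esub> \<in> parabolic_subgroup"
        by (auto simp: one_PSL2C parabolic_subgroup_def intro!: exI[of _ 0])
      then have "\<sigma> (i, j) \<in> \<sigma> (i, j) <#\<^bsub>PSL2C\<^esub> parabolic_subgroup"
        using D(2)[of i j] group.is_monoid[OF group_PSL2C] k j
        by (force simp: l_coset_def intro: monoid.r_one[symmetric])
      then have "\<sigma> (i, j) \<in> \<sigma> (i, k) <#\<^bsub>PSL2C\<^esub> parabolic_subgroup"
        using D(4)[of i j k] k j False by simp
      then obtain b where "\<sigma> (i, j) = \<sigma> (i, k) \<otimes>\<^bsub>PSL2C\<^esub> proj_class (mat2 1 b 0 1)"
        by (auto simp: l_coset_def parabolic_subgroup_def)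
      then have "\<sigma> (i, j) = proj_class (A ** mat2 1 b 0 1)"
        using A by (simp add: proj_class_mult det_2)
      moreover have "det (A ** mat2 1 b 0 1) = 1"
        using A(1) by (simp add: det_mul det_2[of "mat2 1 b 0 1"])
      ultimately show ?thesis
        by (intro exI[of _ "A ** mat2 1 b 0 1"]) (simp add: matrix_mult_nth_2)
    qed
    then show ?thesis
      by blast
  qed blast
  then show ?thesis
    using that by metis
qed

text \<open>The lower left entry of \<open>adj2 A ** B\<close> is the minor of the two first
  columns. Counter diagonality makes it nonzero, and squaring removes the sign chosen by
  \<open>low_left\<close>.\<close>

lemma low_left_edge_elt:
  assumes Log: "log_branch Log"
    and A: "det A = 1" "\<sigma> (i, j) = proj_class A" "A $ 1 $ 1 = a" "A $ 2 $ 1 = c"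
    and B: "det B = 1" "\<sigma> (j, i) = proj_class B" "B $ 1 $ 1 = a'" "B $ 2 $ 1 = c'"
    and cd: "counter_diagonal (edge_elt \<sigma> i j)"
  shows "a * c' - a' * c \<noteq> 0"
    "exp (Log (low_left Log (edge_elt \<sigma> i j))) ^ 2 = (a * c' - a' * c)\<^sup>2"
proof -
  have e: "edge_elt \<sigma> i j = proj_class (adj2 A ** B)"
    using A B by (simp add: edge_elt_def proj_class_inv proj_class_mult)
  have entry: "(adj2 A ** B) $ 2 $ 1 = a * c' - a' * c"
    using A B by (simp add: adj2_def matrix_mult_nth_2)
  obtain d where d: "d \<noteq> 0" "proj_class (adj2 A ** B) = proj_class (mat2 0 (- inverse d) d 0)"
    using cd by (auto simp: counter_diagonal_def e)
  then have "adj2 A ** B = mat2 0 (- inverse d) d 0 \<or> adj2 A ** B = - mat2 0 (- inverse d) d 0"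
    unfolding proj_class_eq by blast
  then have "(adj2 A ** B) $ 2 $ 1 \<noteq> 0"
    using d(1) by auto
  then show nz: "a * c' - a' * c \<noteq> 0"
    by (simp add: entry)
  have "low_left Log (edge_elt \<sigma> i j) = exp (Log ((a * c' - a' * c)\<^sup>2) / 2)"
    using low_left_proj_class[OF Log, of "adj2 A ** B"] nz by (simp add: e entry)
  then have "exp (Log (low_left Log (edge_elt \<sigma> i j))) ^ 2 = exp (Log ((a * c' - a' * c)\<^sup>2))"
    using Log by (simp add: log_branch_def power2_eq_square flip: exp_add)
  also have "\<dots> = (a * c' - a' * c)\<^sup>2"
    using Log nz by (simp add: log_branch_def)
  finally show "exp (Log (low_left Log (edge_elt \<sigma> i j))) ^ 2 = (a * c' - a' * c)\<^sup>2" .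
qed


section \<open>The flattening of a truncated 3-simplex\<close>

text \<open>From \<open>exp (2 * w) = exp (2 * Log z)\<close> the doubled logarithms differ by a
  multiple of 2\<pi>i, so \<open>w\<close> and \<open>Log z\<close> differ by a multiple of \<pi>i:
  exactly the freedom in a flattening.\<close>

lemma log_branch_exp_square_eq:
  assumes "log_branch Log" "z \<noteq> 0" "exp w ^ 2 = z\<^sup>2"
  shows "\<exists>p::int. w = Log z + of_int p * of_real pi * \<i>"
proof -
  have "exp (2 * w) = exp (2 * Log z)"
    using assms by (simp add: log_branch_def exp_double)
  then obtain p :: int where "2 * w = 2 * Log z + of_int (2 * p) * of_real pi * \<i>"
    by (auto simp: exp_eq)
  then have "2 * (w - (Log z + of_int p * of_real pi * \<i>)) = 0"
    by (simp add: algebra_simps)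
  then have "w - (Log z + of_int p * of_real pi * \<i>) = 0"
    by (metis mult_eq_0_iff zero_neq_numeral)
  then show ?thesis
    by (metis right_minus_eq)
qed

text \<open>The columns are homogeneous coordinates of the vertices. A difference of finite vertices
  is \<open>D i j / (c i * c j)\<close>, and these denominators cancel in the cross-ratio. For an
  infinite vertex the two minors containing it share the factor \<open>a i\<close> up to sign,
  matching the two factors that \<open>ediff\<close> drops.\<close>

lemma cross_ratio_columns:
  fixes a c :: "nat \<Rightarrow> complex"
  defines "D \<equiv> \<lambda>i j. a i * c j - a j * c i"
  assumes nz: "\<And>i j. i \<le> 3 \<Longrightarrow> j \<le> 3 \<Longrightarrow> i \<noteq> j \<Longrightarrow> D i j \<noteq> 0"
    and v: "\<And>i. i \<le> 3 \<Longrightarrow> v i = (if c i = 0 then None else Some (a i / c i))"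
  shows "cross_ratio v = D 0 3 * D 1 2 / (D 0 2 * D 1 3)"
proof -
  note One_nat_def [simp del]
  have diff: "ediff (Some (a i / c i)) (Some (a j / c j)) = D i j / (c i * c j)"
    if "c i \<noteq> 0" "c j \<noteq> 0" for i j
    using that by (simp add: D_def divide_simps)
  \<comment> \<open>Nonzero minors allow at most one infinite vertex, which justifies the five cases
    below.\<close>
  have zero: "c i = 0 \<longrightarrow> c j \<noteq> 0 \<and> a i \<noteq> 0" if "i \<le> 3" "j \<le> 3" "i \<noteq> j" for i j
    using nz[OF that] by (auto simp: D_def)
  have vs: "v 0 = (if c 0 = 0 then None else Some (a 0 / c 0))"
    "v 1 = (if c 1 = 0 then None else Some (a 1 / c 1))"
    "v 2 = (if c 2 = 0 then None else Some (a 2 / c 2))"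
    "v 3 = (if c 3 = 0 then None else Some (a 3 / c 3))"
    by (simp_all add: v)
  consider (z0) "c 0 = 0" | (z1) "c 1 = 0" | (z2) "c 2 = 0" | (z3) "c 3 = 0"
    | (nz) "c 0 \<noteq> 0" "c 1 \<noteq> 0" "c 2 \<noteq> 0" "c 3 \<noteq> 0"
    by blast
  then show ?thesis
  proof cases
    case nz
    then show ?thesis
      by (simp add: cross_ratio_def vs diff del: ediff.simps)
  next
    case z0
    then have nz: "c 1 \<noteq> 0" "c 2 \<noteq> 0" "c 3 \<noteq> 0" "a 0 \<noteq> 0"
      using zero[of 0 1] zero[of 0 2] zero[of 0 3] by simp_all
    have "D 0 3 = a 0 * c 3" "D 0 2 = a 0 * c 2"
      using z0 by (simp_all add: D_def)
    then show ?thesis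
      using z0 nz by (simp add: cross_ratio_def vs diff del: ediff.simps(1))
  next
    case z1
    then have nz: "c 0 \<noteq> 0" "c 2 \<noteq> 0" "c 3 \<noteq> 0" "a 1 \<noteq> 0"
      using zero[of 1 0] zero[of 1 2] zero[of 1 3] by simp_all
    have "D 1 2 = a 1 * c 2" "D 1 3 = a 1 * c 3"
      using z1 by (simp_all add: D_def)
    then show ?thesis
      using z1 nz by (simp add: cross_ratio_def vs diff del: ediff.simps(1))
  next
    case z2
    then have nz: "c 0 \<noteq> 0" "c 1 \<noteq> 0" "c 3 \<noteq> 0" "a 2 \<noteq> 0"
      using zero[of 2 0] zero[of 2 1] zero[of 2 3] by simp_all
    have "D 1 2 = - a 2 * c 1" "D 0 2 = - a 2 * c 0"
      using z2 by (simp_all add: D_def)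
    then show ?thesis
      using z2 nz by (simp add: cross_ratio_def vs diff del: ediff.simps(1))
  next
    case z3
    then have nz: "c 0 \<noteq> 0" "c 1 \<noteq> 0" "c 2 \<noteq> 0" "a 3 \<noteq> 0"
      using zero[of 3 0] zero[of 3 1] zero[of 3 2] by simp_all
    have "D 0 3 = - a 3 * c 0" "D 1 3 = - a 3 * c 1"
      using z3 by (simp_all add: D_def)
    then show ?thesis
      using z3 nz by (simp add: cross_ratio_def vs diff mult.commute del: ediff.simps(1))
  qed
qed

lemma one_minus_cross_ratio_columns:
  fixes a c :: "nat \<Rightarrow> complex"
  defines "D \<equiv> \<lambda>i j. a i * c j - a j * c i"
  assumes nz: "\<And>i j. i \<le> 3 \<Longrightarrow> j \<le> 3 \<Longrightarrow> i \<noteq> j \<Longrightarrow> D i j \<noteq> 0"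
    and v: "\<And>i. i \<le> 3 \<Longrightarrow> v i = (if c i = 0 then None else Some (a i / c i))"
  shows "1 - cross_ratio v = D 0 1 * D 2 3 / (D 0 2 * D 1 3)"
proof -
  have "cross_ratio v = D 0 3 * D 1 2 / (D 0 2 * D 1 3)"
    unfolding D_def by (rule cross_ratio_columns) (use nz v in \<open>auto simp: D_def\<close>)
  \<comment> \<open>The Pluecker relation for four columns.\<close>
  moreover have "D 0 2 * D 1 3 - D 0 3 * D 1 2 = D 0 1 * D 2 3"
    by (simp add: D_def algebra_simps)
  moreover have "D 0 2 * D 1 3 \<noteq> 0"
    using nz[of 0 2] nz[of 1 3] by simp
  ultimately show ?thesis
    by (metis diff_divide_distrib divide_self)
qed

text \<open>Each \<open>l i j\<close> is a logarithm of a minor up to sign. The exponentials of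
  \<open>w\<^sub>0\<close> and \<open>- w\<^sub>1\<close> are thus z and 1 - z up to sign, and
  \<open>log_branch_exp_square_eq\<close> supplies p and q.\<close>

lemma is_flattening_columns:
  fixes a c :: "nat \<Rightarrow> complex"
  assumes Log: "log_branch Log"
    and nz: "\<And>i j. i \<le> 3 \<Longrightarrow> j \<le> 3 \<Longrightarrow> i \<noteq> j \<Longrightarrow> a i * c j - a j * c i \<noteq> 0"
    and v: "\<And>i. i \<le> 3 \<Longrightarrow> v i = (if c i = 0 then None else Some (a i / c i))"
    and l: "\<And>i j. i \<le> 3 \<Longrightarrow> j \<le> 3 \<Longrightarrow> i \<noteq> j \<Longrightarrow> exp (l i j) ^ 2 = (a i * c j - a j * c i)\<^sup>2"
  shows "is_flattening Log v
    (l 0 3 + l 1 2 - l 0 2 - l 1 3, l 0 2 + l 1 3 - l 0 1 - l 2 3, l 0 1 + l 2 3 - l 0 3 - l 1 2)"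
proof -
  note One_nat_def [simp del]
  define D where "D = (\<lambda>i j. a i * c j - a j * c i)"
  have nz': "D 0 2 \<noteq> 0" "D 1 3 \<noteq> 0" "D 1 2 \<noteq> 0" "D 0 3 \<noteq> 0" "D 0 1 \<noteq> 0" "D 2 3 \<noteq> 0"
    using nz[of 0 2] nz[of 1 3] nz[of 1 2] nz[of 0 3] nz[of 0 1] nz[of 2 3]
    by (simp_all add: D_def)
  have l': "exp (l 0 2) ^ 2 = (D 0 2)\<^sup>2" "exp (l 1 3) ^ 2 = (D 1 3)\<^sup>2" "exp (l 1 2) ^ 2 = (D 1 2)\<^sup>2"
    "exp (l 0 3) ^ 2 = (D 0 3)\<^sup>2" "exp (l 0 1) ^ 2 = (D 0 1)\<^sup>2" "exp (l 2 3) ^ 2 = (D 2 3)\<^sup>2"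
    by (simp_all add: D_def l)
  define z where "z = cross_ratio v"
  have z: "z = D 0 3 * D 1 2 / (D 0 2 * D 1 3)" and z1: "1 - z = D 0 1 * D 2 3 / (D 0 2 * D 1 3)"
    unfolding z_def D_def using cross_ratio_columns[OF nz v] one_minus_cross_ratio_columns[OF nz v]
    by auto
  have "inj_on v {0..3}"
  proof (rule inj_onI, rule ccontr)
    fix i j
    assume "i \<in> {0..3}" "j \<in> {0..3}" "v i = v j" "i \<noteq> j"
    then have "a i * c j - a j * c i = 0"
      by (auto simp: v divide_simps split: if_splits)
    then show False
      using nz \<open>i \<in> {0..3}\<close> \<open>j \<in> {0..3}\<close> \<open>i \<noteq> j\<close> by simp
  qed
  moreover have "\<exists>p::int. l 0 3 + l 1 2 - l 0 2 - l 1 3 = Log z + of_int p * of_real pi * \<i>"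
    by (rule log_branch_exp_square_eq[OF Log])
      (use nz' in \<open>simp_all add: z exp_add exp_diff power_mult_distrib power_divide l'\<close>)
  \<comment> \<open>\<open>flat\<close> uses \<open>- Log (1 - z)\<close>, so the logarithm lemma is
    applied to the negative of \<open>w\<^sub>1\<close>; the integer obtained changes its sign
    below.\<close>
  moreover have "\<exists>p::int. - (l 0 2 + l 1 3 - l 0 1 - l 2 3) = Log (1 - z) + of_int p * of_real pi * \<i>"
    by (rule log_branch_exp_square_eq[OF Log])
      (use nz' in \<open>simp_all add: z1 exp_minus exp_add exp_diff power_mult_distrib power_divide
        power_inverse l'\<close>)
  ultimately obtain p q :: int where inj: "inj_on v {0..3}"
    and p: "l 0 3 + l 1 2 - l 0 2 - l 1 3 = Log z + of_int p * of_real pi * \<i>"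
    and q: "- (l 0 2 + l 1 3 - l 0 1 - l 2 3) = Log (1 - z) + of_int q * of_real pi * \<i>"
    by blast
  have q': "l 0 2 + l 1 3 - l 0 1 - l 2 3 = - Log (1 - z) + of_int (- q) * of_real pi * \<i>"
    using q by (simp add: algebra_simps)
  have "l 0 1 + l 2 3 - l 0 3 - l 1 2 =
      - (l 0 3 + l 1 2 - l 0 2 - l 1 3) - (l 0 2 + l 1 3 - l 0 1 - l 2 3)"
    by simp
  then show ?thesis
    unfolding is_flattening_def flat_def Let_def z_def[symmetric] using inj p q' by metis
qed

text \<open>Distinct vertices have nonzero minors, and both z and 1 - z are quotients of products of
  minors, so neither vanishes.\<close>

lemma is_flattening_in_flattenings:
  assumes w: "is_flattening Log v w"
  shows "w \<in> flattenings Log"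
proof -
  \<comment> \<open>Homogeneous coordinates: (1, 0) for infinity and (x, 1) for a finite point
    x.\<close>
  define a where "a i = (case v i of None \<Rightarrow> 1 | Some x \<Rightarrow> x)" for i
  define c :: "nat \<Rightarrow> complex" where "c i = (case v i of None \<Rightarrow> 0 | Some x \<Rightarrow> 1)" for i
  have v: "v i = (if c i = 0 then None else Some (a i / c i))" for i
    by (simp add: a_def c_def split: option.split)
  have inj: "inj_on v {0..3}"
    using w by (simp add: is_flattening_def)
  have nz: "a i * c j - a j * c i \<noteq> 0" if "i \<le> 3" "j \<le> 3" "i \<noteq> j" for i j
  proof -
    have "v i \<noteq> v j"
      using inj_onD[OF inj, of i j] that by auto
    then show ?thesis
      by (auto simp: a_def c_def split: option.splits)
  qed
  have "cross_ratio v \<noteq> 0"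
    using cross_ratio_columns[OF nz v] nz[of 0 2] nz[of 1 3] nz[of 1 2] nz[of 0 3] by simp
  moreover have "1 - cross_ratio v \<noteq> 0"
    using one_minus_cross_ratio_columns[OF nz v] nz[of 0 2] nz[of 1 3] nz[of 0 1] nz[of 2 3] by simp
  ultimately show ?thesis
    using w by (auto simp: is_flattening_def flattenings_def)
qed


section \<open>The extended pre-Bloch group\<close>

text \<open>The vertices are defined from the common first columns, which makes them independent of
  the second index of a label.\<close>

lemma trunc_simplex_flattening:
  assumes Log: "log_branch Log" and \<sigma>: "\<sigma> \<in> trunc_simplices 3"
  obtains v where "\<And>i j. i \<le> 3 \<Longrightarrow> j \<le> 3 \<Longrightarrow> i \<noteq> j \<Longrightarrow> v i = apply_infinity (\<sigma> (i, j))"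
    "is_flattening Log v (gen_flattening Log \<sigma>)" "gen_flattening Log \<sigma> \<in> flattenings Log"
proof -
  obtain a c where ac: "\<And>i j. i \<le> 3 \<Longrightarrow> j \<le> 3 \<Longrightarrow> i \<noteq> j \<Longrightarrow>
      \<exists>A. det A = 1 \<and> \<sigma> (i, j) = proj_class A \<and> A $ 1 $ 1 = a i \<and> A $ 2 $ 1 = c i"
    using trunc_simplex_columns[OF \<sigma>] by blast
  define v where "v i = (if c i = 0 then None else Some (a i / c i))" for i
  have edge: "a i * c j - a j * c i \<noteq> 0"
    "exp (Log (low_left Log (edge_elt \<sigma> i j))) ^ 2 = (a i * c j - a j * c i)\<^sup>2"
    if ij: "i \<le> 3" "j \<le> 3" "i \<noteq> j" for i j
  proof -
    obtain A B where "det A = 1" "\<sigma> (i, j) = proj_class A" "A $ 1 $ 1 = a i" "A $ 2 $ 1 = c i"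
      "det B = 1" "\<sigma> (j, i) = proj_class B" "B $ 1 $ 1 = a j" "B $ 2 $ 1 = c j"
      using ac[of i j] ac[of j i] ij by blast
    note * = low_left_edge_elt[OF Log this trunc_simplicesD(5)[OF \<sigma> ij]]
    show "a i * c j - a j * c i \<noteq> 0"
      "exp (Log (low_left Log (edge_elt \<sigma> i j))) ^ 2 = (a i * c j - a j * c i)\<^sup>2"
      by (fact *)+
  qed
  have flat: "is_flattening Log v (gen_flattening Log \<sigma>)"
    unfolding gen_flattening_def Let_def
    by (rule is_flattening_columns[OF Log edge(1) _ edge(2)]) (simp_all add: v_def)
  then have "gen_flattening Log \<sigma> \<in> flattenings Log"
    by (rule is_flattening_in_flattenings)
  moreover have "v i = apply_infinity (\<sigma> (i, j))" if "i \<le> 3" "j \<le> 3" "i \<noteq> j" for i j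
    using ac[OF that] by (auto simp: v_def apply_infinity_proj_class)
  ultimately show ?thesis
    using that flat by blast
qed

section \<open>Truncated 4-simplices and five term relations\<close>

lemma all_pairs_le_4:
  "(\<forall>j k. j < k \<and> k \<le> 4 \<longrightarrow> P j k) \<longleftrightarrow>
    P 0 1 \<and> P 0 2 \<and> P 0 3 \<and> P 0 4 \<and> P 1 2 \<and> P 1 3 \<and> P 1 4 \<and> P 2 3 \<and> P 2 4 \<and> P 3 (4::nat)"
  by (auto simp: le_Suc_eq less_Suc_eq numeral_eq_Suc)

lemma atLeastAtMost_0_4: "{0..4} = {0, 1, 2, 3, 4::nat}"
  by auto

text \<open>One equation per edge, in the order 01, 02, 03, 04, 12, 13, 14, 23, 24, 34. The
  two-element sets are the positions of the edge inside each face.\<close>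

lemma flattening_condition_iff:
  "flattening_condition w \<longleftrightarrow>
    log_param (w 2) {0, 1} - log_param (w 3) {0, 1} + log_param (w 4) {0, 1} = 0 \<and>
    - log_param (w 1) {0, 1} - log_param (w 3) {0, 2} + log_param (w 4) {0, 2} = 0 \<and>
    - log_param (w 1) {0, 2} + log_param (w 2) {0, 2} + log_param (w 4) {0, 3} = 0 \<and>
    - log_param (w 1) {0, 3} + log_param (w 2) {0, 3} - log_param (w 3) {0, 3} = 0 \<and>
    log_param (w 0) {0, 1} - log_param (w 3) {1, 2} + log_param (w 4) {1, 2} = 0 \<and>
    log_param (w 0) {0, 2} + log_param (w 2) {1, 2} + log_param (w 4) {1, 3} = 0 \<and>
    log_param (w 0) {0, 3} + log_param (w 2) {1, 3} - log_param (w 3) {1, 3} = 0 \<and>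
    log_param (w 0) {1, 2} - log_param (w 1) {1, 2} + log_param (w 4) {2, 3} = 0 \<and>
    log_param (w 0) {1, 3} - log_param (w 1) {1, 3} - log_param (w 3) {2, 3} = 0 \<and>
    log_param (w 0) {2, 3} - log_param (w 1) {2, 3} + log_param (w 2) {2, 3} = 0"
  unfolding flattening_condition_def all_pairs_le_4 atLeastAtMost_0_4
  by (simp add: unskip_def algebra_simps insert_Diff_if)

lemma log_param_simps:
  "log_param (x, y, z) {0, 1} = x" "log_param (x, y, z) {2, 3} = x"
  "log_param (x, y, z) {1, 2} = y" "log_param (x, y, z) {0, 3} = y"
  "log_param (x, y, z) {0, 2} = z" "log_param (x, y, z) {1, 3} = z"
  by (simp_all add: log_param_def doubleton_eq_iff)

text \<open>The five faces inherit their ideal vertices and edge elements from the one simplex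
  \<open>\<sigma>\<close>, so flattenings of different faces are written in the same
  logarithms.\<close>

lemma five_term_face_relation:
  assumes Log: "log_branch Log" and \<sigma>: "\<sigma> \<in> trunc_simplices 4"
  shows "(\<Sum>k\<le>4. frag_cmul ((-1) ^ k) (frag_of (gen_flattening Log (trunc_face 4 k \<sigma>))))
    \<in> five_term_rels Log"
proof -
  define w where "w k = gen_flattening Log (trunc_face 4 k \<sigma>)" for k
  \<comment> \<open>The second index is just some index different from \<open>i\<close>; the common
    column at \<open>i\<close> makes the choice immaterial.\<close>
  define z where "z i = apply_infinity (\<sigma> (i, if i = 0 then 1 else 0))" for i
  have face: "trunc_face 4 k \<sigma> \<in> trunc_simplices 3" for k
    using trunc_face_in_trunc_simplices[OF _ \<sigma>] by simp
  have z: "z i = apply_infinity (\<sigma> (i, j))" if "i \<le> 4" "j \<le> 4" "i \<noteq> j" for i j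
  proof -
    obtain a c where ac: "\<And>i j. i \<le> 4 \<Longrightarrow> j \<le> 4 \<Longrightarrow> i \<noteq> j \<Longrightarrow>
        \<exists>A. det A = 1 \<and> \<sigma> (i, j) = proj_class A \<and> A $ 1 $ 1 = a i \<and> A $ 2 $ 1 = c i"
      using trunc_simplex_columns[OF \<sigma>] by blast
    have "apply_infinity (\<sigma> (i, j)) = (if c i = 0 then None else Some (a i / c i))"
      if "i \<le> 4" "j \<le> 4" "i \<noteq> j" for i j
      using ac[OF that] by (auto simp: apply_infinity_proj_class)
    then show ?thesis
      using that by (simp add: z_def)
  qed
  have flat: "is_flattening Log (\<lambda>m. z (skip k m)) (w k)" for k
  proof -
    obtain v where v: "\<And>i j. i \<le> 3 \<Longrightarrow> j \<le> 3 \<Longrightarrow> i \<noteq> j \<Longrightarrow>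
        v i = apply_infinity (trunc_face 4 k \<sigma> (i, j))" and fl: "is_flattening Log v (w k)"
      using trunc_simplex_flattening[OF Log face] unfolding w_def by metis
    \<comment> \<open>The vertices found for the face agree with the restricted \<open>z\<close> at
      the positions 0 to 3, the only ones \<open>is_flattening\<close> inspects.\<close>
    have eq: "v m = z (skip k m)" if "m \<le> 3" for m
    proof -
      define j where "j = (if m = 0 then 1 else 0::nat)"
      have j: "j \<le> 3" "m \<noteq> j"
        by (auto simp: j_def)
      have "v m = apply_infinity (\<sigma> (skip k m, skip k j))"
        using v[OF that j] trunc_face_apply[of m 4 j k \<sigma>] that j by simp
      also have "\<dots> = z (skip k m)"
        by (rule z[symmetric]) (use that j skip_le[of 4] in auto)
      finally show ?thesis .
    qed
    then have "cross_ratio v = cross_ratio (\<lambda>m. z (skip k m))"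
      by (simp add: cross_ratio_def)
    moreover have "inj_on v {0..3} \<longleftrightarrow> inj_on (\<lambda>m. z (skip k m)) {0..3}"
      by (rule inj_on_cong) (simp add: eq)
    ultimately show ?thesis
      using fl by (simp add: is_flattening_def)
  qed
  have "inj_on z {0..4}"
  proof (rule inj_onI, rule ccontr)
    fix i j
    assume ij: "i \<in> {0..4}" "j \<in> {0..4}" "z i = z j" "i \<noteq> j"
    \<comment> \<open>Some \<open>k\<close> avoids both \<open>i\<close> and \<open>j\<close>; then
      both vertices lie in the face opposite \<open>k\<close>, whose vertices are distinct.\<close>
    have "\<not> {0, 1, 2} \<subseteq> {i, j}"
      by auto
    then obtain k where "k \<in> {0, 1, 2}" "k \<notin> {i, j}"
      by (meson subsetI)
    then have k: "k \<noteq> i" "k \<noteq> j" "k \<le> 4"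
      by auto
    have "skip k (unskip k i) = i" "skip k (unskip k j) = j" "unskip k i \<le> 3" "unskip k j \<le> 3"
      using ij k by (auto simp: skip_def unskip_def)
    moreover have "inj_on (\<lambda>m. z (skip k m)) {0..3}"
      using flat by (simp add: is_flattening_def)
    ultimately show False
      using ij inj_onD[of "\<lambda>m. z (skip k m)" "{0..3}" "unskip k i" "unskip k j"] by auto
  qed
  moreover have "flattening_condition w"
  proof -
    define l where "l i j = Log (low_left Log (edge_elt \<sigma> i j))" for i j
    have w: "w k = (l (skip k 0) (skip k 3) + l (skip k 1) (skip k 2)
          - l (skip k 0) (skip k 2) - l (skip k 1) (skip k 3),
        l (skip k 0) (skip k 2) + l (skip k 1) (skip k 3)
          - l (skip k 0) (skip k 1) - l (skip k 2) (skip k 3),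
        l (skip k 0) (skip k 1) + l (skip k 2) (skip k 3)
          - l (skip k 0) (skip k 3) - l (skip k 1) (skip k 2))" for k
      by (simp add: w_def gen_flattening_def l_def edge_elt_trunc_face)
    show ?thesis
      \<comment> \<open>Each of the ten equations is now an identity in the \<open>l i j\<close>; as
        \<open>skip\<close> is increasing, shared edges occur with the same index order in all
        faces.\<close>
      unfolding flattening_condition_iff w log_param_simps
      by (simp add: skip_def flip: numeral_2_eq_2)
  qed
  moreover have "{..4} = {0..4::nat}"
    by auto
  ultimately show ?thesis
    using flat unfolding five_term_rels_def w_def[symmetric] by auto
qed

section \<open>The relations of the extended pre-Bloch group and their images under \<nu>\<close>

lemma Phat_generators_subset:
  "five_term_rels Log \<union> transfer_rels Log \<subseteq> carrier (free_Abelian_group (flattenings Log))"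
proof -
  note F = subgroup_free_Abelian_groupD[OF group.subgroup_self[OF group_free_Abelian_group]]
  have "x \<in> carrier (free_Abelian_group (flattenings Log))" if "x \<in> transfer_rels Log" for x
  proof -
    have "frag_of (flat Log z p q) \<in> carrier (free_Abelian_group (flattenings Log))"
      if "z \<noteq> 0" "z \<noteq> 1" for z p q
      using that by (auto simp: flattenings_def)
    then show ?thesis
      using that unfolding transfer_rels_def by (auto simp del: carrier_free_Abelian_group_iff intro!: F)
  qed
  moreover have "x \<in> carrier (free_Abelian_group (flattenings Log))" if five: "x \<in> five_term_rels Log" for x
  proof -
    obtain z w where x: "x = (\<Sum>i\<in>{0..4}. frag_cmul ((-1) ^ i) (frag_of (w i)))"
      and "\<forall>i\<le>4. is_flattening Log (\<lambda>m. z (skip i m)) (w i)"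
      using five by (auto simp: five_term_rels_def)
    then have "w i \<in> flattenings Log" if "i \<in> {0..4}" for i
      using that by (auto intro: is_flattening_in_flattenings)
    then show ?thesis
      unfolding x
      by (intro subgroup_alternating_sum[OF group.subgroup_self[OF group_free_Abelian_group]]) simp
  qed
  ultimately show ?thesis
    by blast
qed

lemma subgroup_Phat_rels: "subgroup (Phat_rels Log) (free_Abelian_group (flattenings Log))"
  unfolding Phat_rels_def
  by (rule subgroup_generate_free_Abelian_group[OF Phat_generators_subset])

text \<open>The lift of \<nu> to free abelian groups, that is \<open>nu_free\<close> before passing
  to cosets of \<open>wedge_rels\<close>.\<close>

definition nu_frag :: "(flattening \<Rightarrow>\<^sub>0 int) \<Rightarrow> (complex \<times> complex \<Rightarrow>\<^sub>0 int)" where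
  "nu_frag = frag_extend (\<lambda>(w0, w1, w2). frag_of (w0, w1))"

lemma nu_five_term:
  assumes w: "flattening_condition w" "\<And>i. i \<le> 4 \<Longrightarrow> \<exists>x y. w i = (x, y, - x - y)"
  shows "nu_frag (\<Sum>i\<in>{0..4}. frag_cmul ((-1) ^ i) (frag_of (w i))) \<in> wedge_rels"
proof -
  obtain x0 y0 where w0: "w 0 = (x0, y0, - x0 - y0)" using w(2)[of 0] by auto
  obtain x1 y1 where w1: "w 1 = (x1, y1, - x1 - y1)" using w(2)[of 1] by auto
  obtain x2 y2 where w2: "w 2 = (x2, y2, - x2 - y2)" using w(2)[of 2] by auto
  obtain x3 y3 where w3: "w 3 = (x3, y3, - x3 - y3)" using w(2)[of 3] by auto
  obtain x4 y4 where w4: "w 4 = (x4, y4, - x4 - y4)" using w(2)[of 4] by auto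
  note eqs = w(1)[unfolded flattening_condition_iff w0 w1 w2 w3 w4 log_param_simps]
  \<comment> \<open>The five eliminations come from the edges 34, 23, 01, 04 and 12, in this order;
    \<open>x0\<close>, \<open>x1\<close>, \<open>y0\<close>, \<open>y1\<close>, \<open>y2\<close>
    remain as parameters.\<close>
  have x2: "x2 = x1 - x0"
    using eqs by (simp add: algebra_simps)
  have x4: "x4 = y1 - y0"
    using eqs by (simp add: algebra_simps)
  have x3: "x3 = x1 - x0 + (y1 - y0)"
    using eqs unfolding x2 x4 by (simp add: algebra_simps)
  have y3: "y3 = y2 - y1"
    using eqs by (simp add: algebra_simps)
  have y4: "y4 = y2 - y1 - x0"
    using eqs unfolding y3 by (simp add: algebra_simps)
  \<comment> \<open>After bilinear expansion the remaining terms cancel by antisymmetry.\<close>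
  have "wedge x0 y0 - wedge x1 y1 + wedge x2 y2 - wedge x3 y3 + wedge x4 y4 = 0"
    unfolding x2 x3 x4 y3 y4
    by (simp add: wedge_bilinear wedge_swap[of y0 x0] wedge_swap[of y1 x0] wedge_swap[of y1 y0])
  then show ?thesis
    unfolding abs_wedge2_eq_0_iff[symmetric] atLeastAtMost_0_4 nu_frag_def
    by (simp add: frag_extend_add frag_extend_diff w0 w1[unfolded One_nat_def] w2 w3 w4 wedge_def
        algebra_simps Modules.additive.add[OF additive_abs_wedge2] Modules.additive.diff[OF additive_abs_wedge2])
qed

text \<open>In the bilinear expansion the terms free of or linear in the integers cancel in pairs,
  and the others are integer multiples of \<pi>i wedged with each other.\<close>

lemma nu_transfer:
  assumes "x \<in> transfer_rels Log"
  shows "nu_frag x \<in> wedge_rels"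
proof -
  obtain z p q p' q' where x: "x = frag_of (flat Log z p q) + frag_of (flat Log z p' q')
      - frag_of (flat Log z p q') - frag_of (flat Log z p' q)"
    using assms by (auto simp: transfer_rels_def)
  let ?t = "of_real pi * \<i>"
  have "wedge (a + of_int p * ?t) (b + of_int q * ?t) + wedge (a + of_int p' * ?t) (b + of_int q' * ?t)
      - wedge (a + of_int p * ?t) (b + of_int q' * ?t)
      - wedge (a + of_int p' * ?t) (b + of_int q * ?t) = 0" for a b
    unfolding wedge_bilinear wedge_of_int_multiples by simp
  from this[of "Log z" "- Log (1 - z)"] show ?thesis
    unfolding abs_wedge2_eq_0_iff[symmetric] nu_frag_def x
    by (simp add: frag_extend_add frag_extend_diff flat_def Let_def wedge_def mult.assoc
        Modules.additive.add[OF additive_abs_wedge2] Modules.additive.diff[OF additive_abs_wedge2])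
qed

text \<open>This makes \<open>nu_free\<close> constant on cosets of \<open>Phat_rels\<close>, so
  that \<open>nu_hat\<close> takes the intended values.\<close>

lemma nu_Phat_rels:
  assumes "x \<in> Phat_rels Log"
  shows "nu_frag x \<in> wedge_rels"
  using Phat_generators_subset assms[unfolded Phat_rels_def] subgroup_wedge_rels
proof (rule generate_free_Abelian_group_image)
  show "Modules.additive nu_frag"
    unfolding nu_frag_def by (rule additive_frag_extend)
  fix t
  assume "t \<in> five_term_rels Log \<union> transfer_rels Log"
  then show "nu_frag t \<in> wedge_rels"
  proof
    assume "t \<in> five_term_rels Log"
    then obtain z w where t: "t = (\<Sum>i\<in>{0..4}. frag_cmul ((-1) ^ i) (frag_of (w i)))"
      and flat: "\<forall>i\<le>4. is_flattening Log (\<lambda>m. z (skip i m)) (w i)" and cond: "flattening_condition w"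
      by (auto simp: five_term_rels_def)
    show ?thesis
      unfolding t
      by (rule nu_five_term[OF cond])
        (use flat in \<open>force simp: is_flattening_def flat_def Let_def\<close>)
  qed (rule nu_transfer)
qed


section \<open>The homomorphism \<open>\<Psi>\<close>\<close>

lemma coinv_generators_subset:
  "{frag_of (act n g \<sigma>) - frag_of \<sigma> | g \<sigma>. g \<in> carrier PSL2C \<and> \<sigma> \<in> trunc_simplices n}
    \<subseteq> carrier (free_Abelian_group (trunc_simplices n))"
proof -
  note F = subgroup_free_Abelian_groupD[OF group.subgroup_self[OF group_free_Abelian_group]]
  show ?thesis
    by (auto simp del: carrier_free_Abelian_group_iff intro!: F act_in_trunc_simplices)
qed

lemma subgroup_coinv_rels: "subgroup (coinv_rels n) (free_Abelian_group (trunc_simplices n))"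
  unfolding coinv_rels_def trunc_chains_def
  by (rule subgroup_generate_free_Abelian_group[OF coinv_generators_subset])

text \<open>Used for the boundary, for flattenings and for \<mu> alike: invariance needs to be
  tested only on single simplices.\<close>

lemma coinv_rels_image:
  assumes "x \<in> coinv_rels n" "subgroup M (free_Abelian_group S)" "Modules.additive f"
    "\<And>g \<sigma>. g \<in> carrier PSL2C \<Longrightarrow> \<sigma> \<in> trunc_simplices n \<Longrightarrow>
      f (frag_of (act n g \<sigma>)) - f (frag_of \<sigma>) \<in> M"
  shows "f x \<in> M"
  by (rule generate_free_Abelian_group_image[OF coinv_generators_subset
        assms(1)[unfolded coinv_rels_def trunc_chains_def] assms(2,3)])
    (use assms(4) in \<open>auto simp: Modules.additive.diff[OF assms(3)]\<close>)

lemma additive_trunc_boundary: "Modules.additive (trunc_boundary n)"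
  unfolding trunc_boundary_def by (rule additive_frag_extend)

lemma trunc_boundary_frag_of:
  "trunc_boundary n (frag_of \<sigma>) = (\<Sum>k\<le>n. frag_cmul ((-1) ^ k) (frag_of (trunc_face n k \<sigma>)))"
  by (simp add: trunc_boundary_def)

lemma trunc_boundary_in_chains:
  assumes "1 \<le> n" "x \<in> carrier (free_Abelian_group (trunc_simplices n))"
  shows "trunc_boundary n x \<in> carrier (free_Abelian_group (trunc_simplices (n - 1)))"
proof (rule free_Abelian_group_image[OF assms(2) _ additive_trunc_boundary])
  show "subgroup (carrier (free_Abelian_group (trunc_simplices (n - 1))))
      (free_Abelian_group (trunc_simplices (n - 1)))"
    by (intro group.subgroup_self group_free_Abelian_group)
  show "trunc_boundary n (frag_of \<sigma>) \<in> carrier (free_Abelian_group (trunc_simplices (n - 1)))"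
    if "\<sigma> \<in> trunc_simplices n" for \<sigma>
    unfolding trunc_boundary_frag_of
    using trunc_face_in_trunc_simplices[OF assms(1) that]
    by (intro subgroup_alternating_sum[OF group.subgroup_self[OF group_free_Abelian_group]]) simp
qed

text \<open>Faces commute with the action, so a generating relation is sent to an alternating sum of
  generating relations for the faces.\<close>

lemma trunc_boundary_coinv_rels:
  assumes "1 \<le> n" "x \<in> coinv_rels n"
  shows "trunc_boundary n x \<in> coinv_rels (n - 1)"
proof (rule coinv_rels_image[OF assms(2) subgroup_coinv_rels additive_trunc_boundary])
  fix g \<sigma>
  assume g: "g \<in> carrier PSL2C" and \<sigma>: "\<sigma> \<in> trunc_simplices n"
  have "frag_of (act (n - 1) g (trunc_face n k \<sigma>)) - frag_of (trunc_face n k \<sigma>) \<in> coinv_rels (n - 1)" for k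
    using g trunc_face_in_trunc_simplices[OF assms(1) \<sigma>]
    unfolding coinv_rels_def by (intro generate.incl) blast
  then have "(\<Sum>k\<le>n. frag_cmul ((-1) ^ k)
      (frag_of (act (n - 1) g (trunc_face n k \<sigma>)) - frag_of (trunc_face n k \<sigma>))) \<in> coinv_rels (n - 1)"
    by (intro subgroup_alternating_sum[OF subgroup_coinv_rels])
  moreover have "frag_cmul c (x - y) = frag_cmul c x - frag_cmul c y" for c and x y :: "labeling \<Rightarrow>\<^sub>0 int"
    by (simp add: poly_mapping_eqI lookup_minus right_diff_distrib)
  ultimately show "trunc_boundary n (frag_of (act n g \<sigma>)) - trunc_boundary n (frag_of \<sigma>)
      \<in> coinv_rels (n - 1)"
    by (simp add: trunc_boundary_frag_of trunc_face_act[OF assms(1)] sum_subtractf)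
qed

lemma group_Bbar: "group (Bbar n)"
  unfolding Bbar_def trunc_chains_def by (rule group_free_Abelian_group_Mod[OF subgroup_coinv_rels])

lemma carrier_Bbar:
  "carrier (Bbar n) = Bbar_class n ` carrier (free_Abelian_group (trunc_simplices n))"
  by (auto simp: Bbar_def Bbar_class_def trunc_chains_def carrier_FactGroup)

lemma Bbar_class_eq_one_iff: "Bbar_class n x = \<one>\<^bsub>Bbar n\<^esub> \<longleftrightarrow> x \<in> coinv_rels n"
  using r_coset_eq_one_free_Abelian_group[OF subgroup_coinv_rels]
  by (simp add: Bbar_def Bbar_class_def trunc_chains_def)

lemma Bbar_boundary_class:
  assumes "1 \<le> n" "x \<in> carrier (free_Abelian_group (trunc_simplices n))"
  shows "Bbar_boundary n (Bbar_class n x) = Bbar_class (n - 1) (trunc_boundary n x)"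
proof -
  have "(\<lambda>x. Bbar_class (n - 1) (trunc_boundary n x))
      \<in> hom (free_Abelian_group (trunc_simplices n)) (Bbar (n - 1))"
    unfolding Bbar_class_def Bbar_def trunc_chains_def
    by (rule r_coset_additive_hom[OF subgroup_coinv_rels additive_trunc_boundary])
      (rule trunc_boundary_in_chains[OF assms(1)])
  moreover have "Bbar_class (n - 1) (trunc_boundary n y) = \<one>\<^bsub>Bbar (n - 1)\<^esub>" if "y \<in> coinv_rels n" for y
    unfolding Bbar_class_eq_one_iff by (rule trunc_boundary_coinv_rels[OF assms(1) that])
  moreover have "coinv_rels n \<noteq> {}"
    using subgroup_free_Abelian_groupD(1)[OF subgroup_coinv_rels] by blast
  ultimately show ?thesis
    unfolding Bbar_boundary_def Bbar_class_def[of n] trunc_chains_def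
    by (intro induced_r_coset[OF group_Bbar _ subgroup.subset[OF subgroup_coinv_rels] _ _ assms(2)])
qed

section \<open>\<Psi> on chains, its invariance, and its values on boundaries and cycles\<close>

definition flattening_frag ::
  "(complex \<Rightarrow> complex) \<Rightarrow> (labeling \<Rightarrow>\<^sub>0 int) \<Rightarrow> (flattening \<Rightarrow>\<^sub>0 int)" where
  "flattening_frag Log = frag_extend (frag_of \<circ> gen_flattening Log)"

lemma additive_flattening_frag: "Modules.additive (flattening_frag Log)"
  unfolding flattening_frag_def by (rule additive_frag_extend)

lemma flattening_frag_of [simp]:
  "flattening_frag Log (frag_of \<sigma>) = frag_of (gen_flattening Log \<sigma>)"
  by (simp add: flattening_frag_def)

lemma gen_flattening_act:
  assumes "\<sigma> \<in> trunc_simplices 3" "g \<in> carrier PSL2C"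
  shows "gen_flattening Log (act 3 g \<sigma>) = gen_flattening Log \<sigma>"
  using edge_elt_act[OF assms] by (simp add: gen_flattening_def)

lemma flattening_frag_coinv_rels:
  assumes "x \<in> coinv_rels 3"
  shows "flattening_frag Log x \<in> Phat_rels Log"
  by (rule coinv_rels_image[OF assms subgroup_Phat_rels additive_flattening_frag])
    (simp add: gen_flattening_act subgroup_free_Abelian_groupD(1)[OF subgroup_Phat_rels])

text \<open>For a single simplex the image of the boundary is itself a five term generator of
  \<open>Phat_rels\<close>; additivity does the rest.\<close>

lemma flattening_frag_boundary:
  assumes "log_branch Log" "x \<in> carrier (free_Abelian_group (trunc_simplices 4))"
  shows "flattening_frag Log (trunc_boundary 4 x) \<in> Phat_rels Log"
proof (rule free_Abelian_group_image[OF assms(2) subgroup_Phat_rels])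
  show "Modules.additive (\<lambda>x. flattening_frag Log (trunc_boundary 4 x))"
    using Modules.additive.add[OF additive_flattening_frag]
      Modules.additive.add[OF additive_trunc_boundary]
    by (simp add: Modules.additive_def)
  fix \<sigma>
  assume "\<sigma> \<in> trunc_simplices 4"
  from five_term_face_relation[OF assms(1) this]
  show "flattening_frag Log (trunc_boundary 4 (frag_of \<sigma>)) \<in> Phat_rels Log"
    unfolding Phat_rels_def
    by (intro generate.incl)
      (simp add: trunc_boundary_frag_of flattening_frag_def frag_extend_sum frag_extend_cmul comp_def)
qed

text \<open>A chain-level primitive of \<open>\<nu>\<close>: on \<open>3\<close>-chains, \<open>\<nu> \<circ> \<Psi> = - \<mu> \<circ> \<partial>\<close>.\<close>

definition mu_frag ::
  "(complex \<Rightarrow> complex) \<Rightarrow> (labeling \<Rightarrow>\<^sub>0 int) \<Rightarrow> (complex \<times> complex \<Rightarrow>\<^sub>0 int)" where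
  "mu_frag Log = frag_extend (\<lambda>\<sigma>.
     let l = (\<lambda>i j. Log (low_left Log (edge_elt \<sigma> i j)))
     in frag_of (l 0 1, l 1 2) + frag_of (l 1 2, l 0 2) + frag_of (l 0 2, l 0 1))"

lemma additive_mu_frag: "Modules.additive (mu_frag Log)"
  unfolding mu_frag_def by (rule additive_frag_extend)

text \<open>A cycle in \<open>Bbar 3\<close> has a representative whose boundary is zero only modulo
  \<open>coinv_rels 2\<close>. Since \<mu> uses edge elements alone, it still kills this boundary
  modulo \<open>wedge_rels\<close>.\<close>

lemma mu_coinv_rels:
  assumes "x \<in> coinv_rels 2"
  shows "mu_frag Log x \<in> wedge_rels"
proof (rule coinv_rels_image[OF assms subgroup_wedge_rels additive_mu_frag])
  fix g \<sigma>
  assume "g \<in> carrier PSL2C" "\<sigma> \<in> trunc_simplices 2"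
  from edge_elt_act[OF this(2,1)]
  have "mu_frag Log (frag_of (act 2 g \<sigma>)) = mu_frag Log (frag_of \<sigma>)"
    by (simp add: mu_frag_def)
  then show "mu_frag Log (frag_of (act 2 g \<sigma>)) - mu_frag Log (frag_of \<sigma>) \<in> wedge_rels"
    by (simp add: subgroup_free_Abelian_groupD(1)[OF subgroup_wedge_rels])
qed

text \<open>Two edges sharing a vertex span exactly one face. The twelve such pairs in the expansion
  of \<open>w\<^sub>0 \<and> w\<^sub>1\<close> match the three terms of \<mu> on each of the four
  faces. Of the opposite pairs only 02, 13 occurs, once in each order, and cancels.\<close>

lemma nu_flattening_frag:
  assumes "x \<in> carrier (free_Abelian_group (trunc_simplices 3))"
  shows "nu_frag (flattening_frag Log x) + mu_frag Log (trunc_boundary 3 x) \<in> wedge_rels"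
proof (rule free_Abelian_group_image[OF assms subgroup_wedge_rels])
  show "Modules.additive (\<lambda>x. nu_frag (flattening_frag Log x) + mu_frag Log (trunc_boundary 3 x))"
    using Modules.additive.add[OF additive_flattening_frag]
      Modules.additive.add[OF additive_trunc_boundary] Modules.additive.add[OF additive_mu_frag]
    by (simp add: Modules.additive_def nu_frag_def frag_extend_add)
  fix \<sigma>
  assume "\<sigma> \<in> trunc_simplices 3"
  define l where "l i j = Log (low_left Log (edge_elt \<sigma> i j))" for i j
  have atMost: "{..3} = {0, 1, 2, 3::nat}"
    by auto
  have nu: "abs_wedge2 (nu_frag (flattening_frag Log (frag_of \<sigma>))) =
      wedge (l 0 3 + l 1 2 - l 0 2 - l 1 3) (l 0 2 + l 1 3 - l 0 1 - l 2 3)"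
    by (simp add: nu_frag_def gen_flattening_def Let_def l_def wedge_def)
  have face: "abs_wedge2 (mu_frag Log (frag_of (trunc_face 3 k \<sigma>))) =
      wedge (l (skip k 0) (skip k 1)) (l (skip k 1) (skip k 2))
      + wedge (l (skip k 1) (skip k 2)) (l (skip k 0) (skip k 2))
      + wedge (l (skip k 0) (skip k 2)) (l (skip k 0) (skip k 1))" for k
    by (simp add: mu_frag_def Let_def edge_elt_trunc_face l_def wedge_def
        Modules.additive.add[OF additive_abs_wedge2])
  interpret m: Modules.additive "\<lambda>x. abs_wedge2 (mu_frag Log x)"
    using Modules.additive.add[OF additive_mu_frag] Modules.additive.add[OF additive_abs_wedge2]
    by (simp add: Modules.additive_def)
  have mu: "abs_wedge2 (mu_frag Log (trunc_boundary 3 (frag_of \<sigma>))) =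
      abs_wedge2 (mu_frag Log (frag_of (trunc_face 3 0 \<sigma>)))
      - abs_wedge2 (mu_frag Log (frag_of (trunc_face 3 1 \<sigma>)))
      + abs_wedge2 (mu_frag Log (frag_of (trunc_face 3 2 \<sigma>)))
      - abs_wedge2 (mu_frag Log (frag_of (trunc_face 3 3 \<sigma>)))"
    unfolding trunc_boundary_frag_of atMost by (simp add: m.add m.diff algebra_simps)
  have "abs_wedge2 (nu_frag (flattening_frag Log (frag_of \<sigma>)))
      + abs_wedge2 (mu_frag Log (trunc_boundary 3 (frag_of \<sigma>))) = 0"
    unfolding nu mu face
    by (simp add: skip_def wedge_bilinear wedge_swap[of "l 0 2" "l 0 3"]
        wedge_swap[of "l 0 3" "l (Suc 0) 3"] wedge_swap[of "l (Suc 0) 2" "l (Suc 0) 3"]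
        wedge_swap[of "l 0 2" "l (Suc 0) 3"] wedge_swap[of "l 0 (Suc 0)" "l (Suc 0) 2"]
        wedge_swap[of "l 0 (Suc 0)" "l (Suc 0) 3"] wedge_swap[of "l 0 3" "l 2 3"]
        wedge_swap[of "l (Suc 0) 3" "l 2 3"] flip: numeral_2_eq_2)
  then show "nu_frag (flattening_frag Log (frag_of \<sigma>)) + mu_frag Log (trunc_boundary 3 (frag_of \<sigma>))
      \<in> wedge_rels"
    by (simp add: Modules.additive.add[OF additive_abs_wedge2] flip: abs_wedge2_eq_0_iff)
qed

text \<open>Turns membership in the kernel of \<open>nu_hat\<close> into a condition on chains, the
  form in which the identity with \<mu> applies.\<close>

lemma nu_hat_r_coset:
  assumes "y \<in> carrier (free_Abelian_group (flattenings Log))"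
  shows "nu_hat (Phat_rels Log #>\<^bsub>free_Abelian_group (flattenings Log)\<^esub> y) = \<one>\<^bsub>Wedge2C\<^esub>
    \<longleftrightarrow> nu_frag y \<in> wedge_rels"
proof -
  have nu_free: "nu_free x = wedge_rels #>\<^bsub>free_Abelian_group UNIV\<^esub> nu_frag x" for x
    by (simp add: nu_free_def nu_frag_def)
  have one: "nu_free x = \<one>\<^bsub>Wedge2C\<^esub>" if "x \<in> Phat_rels Log" for x
    using nu_Phat_rels[OF that]
    by (simp add: nu_free Wedge2C_def r_coset_eq_one_free_Abelian_group[OF subgroup_wedge_rels])
  have "nu_free \<in> hom (free_Abelian_group (flattenings Log)) Wedge2C"
    unfolding nu_free Wedge2C_def nu_frag_def
    by (rule r_coset_additive_hom[OF subgroup_wedge_rels additive_frag_extend]) simp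
  then have "nu_hat (Phat_rels Log #>\<^bsub>free_Abelian_group (flattenings Log)\<^esub> y) = nu_free y"
    unfolding nu_hat_def
    using subgroup_free_Abelian_groupD(1)[OF subgroup_Phat_rels]
    by (intro induced_r_coset[OF _ _ subgroup.subset[OF subgroup_Phat_rels] _ one assms])
      (auto simp: Wedge2C_def group_free_Abelian_group_Mod[OF subgroup_wedge_rels])
  then show ?thesis
    by (simp add: nu_free Wedge2C_def r_coset_eq_one_free_Abelian_group[OF subgroup_wedge_rels])
qed

theorem theorem3p17:
  fixes Log :: "complex \<Rightarrow> complex"
  assumes "log_branch Log"
  shows "(\<forall>\<sigma>\<in>trunc_simplices 3. \<exists>v.
            (\<forall>(i, j)\<in>trunc_vertices 3. v i = apply_infinity (\<sigma> (i, j))) \<and>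
            is_flattening Log v (gen_flattening Log \<sigma>)) \<and>
         (\<exists>\<Psi> \<in> hom (Bbar 3) (Phat Log).
            (\<forall>\<sigma>\<in>trunc_simplices 3.
               \<Psi> (Bbar_class 3 (frag_of \<sigma>)) = Phat_class Log (gen_flattening Log \<sigma>)) \<and>
            (\<forall>x\<in>Bbar_boundaries 3. \<Psi> x = \<one>\<^bsub>Phat Log\<^esub>) \<and>
            (\<forall>x\<in>Bbar_cycles 3. \<Psi> x \<in> carrier (Bhat Log)) \<and>
            (\<exists>\<Psi>H \<in> hom (rel_homology 3) (Bhat Log).
               \<forall>x\<in>Bbar_cycles 3. \<Psi>H (homology_class 3 x) = \<Psi> x))"
proof -
  let ?C = "\<lambda>n. free_Abelian_group (trunc_simplices n)"
  let ?F = "free_Abelian_group (flattenings Log)"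
  \<comment> \<open>\<open>\<psi>\<close> lives on 3-chains; \<open>\<Psi>\<close> is what it
    induces on coinvariants.\<close>
  define \<psi> where "\<psi> x = Phat_rels Log #>\<^bsub>?F\<^esub> flattening_frag Log x" for x
  define \<Psi> where "\<Psi> = induced \<psi>"
  have group_Phat: "group (Phat Log)"
    unfolding Phat_def by (rule group_free_Abelian_group_Mod[OF subgroup_Phat_rels])
  have flattening_frag: "flattening_frag Log x \<in> carrier ?F" if "x \<in> carrier (?C 3)" for x
    unfolding flattening_frag_def using trunc_simplex_flattening[OF assms]
    by (intro frag_extend_in_free_Abelian_group[OF that]) (metis comp_apply frag_of_in_free_Abelian_group)
  have \<psi>: "\<psi> \<in> hom (?C 3) (Phat Log)"
    unfolding \<psi>_def Phat_def using flattening_frag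
    by (intro r_coset_additive_hom subgroup_Phat_rels additive_flattening_frag)
  have \<psi>_one: "\<psi> x = \<one>\<^bsub>Phat Log\<^esub> \<longleftrightarrow> flattening_frag Log x \<in> Phat_rels Log" for x
    by (simp add: \<psi>_def Phat_def r_coset_eq_one_free_Abelian_group[OF subgroup_Phat_rels])
  have coinv: "coinv_rels 3 \<subseteq> carrier (?C 3)" "coinv_rels 3 \<noteq> {}"
    using subgroup.subset[OF subgroup_coinv_rels] subgroup_free_Abelian_groupD(1)[OF subgroup_coinv_rels]
    by auto
  have \<Psi>: "\<Psi> \<in> hom (Bbar 3) (Phat Log)"
    unfolding \<Psi>_def Bbar_def trunc_chains_def
    using \<psi>_one flattening_frag_coinv_rels
    by (intro induced_hom_Mod group_free_Abelian_group group_Phat \<psi> coinv) auto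
  have \<Psi>_class: "\<Psi> (Bbar_class 3 x) = \<psi> x" if "x \<in> carrier (?C 3)" for x
    unfolding \<Psi>_def Bbar_class_def trunc_chains_def
    using \<psi>_one flattening_frag_coinv_rels
    by (intro induced_r_coset[OF group_Phat \<psi> coinv _ that]) auto
  \<comment> \<open>Both facts are inputs to the later quotient by boundaries: they form a subset of
    the group, and \<open>\<Psi>\<close> kills them.\<close>
  have boundaries: "X \<in> carrier (Bbar 3)" "\<Psi> X = \<one>\<^bsub>Phat Log\<^esub>" if "X \<in> Bbar_boundaries 3" for X
  proof -
    obtain y where y: "y \<in> carrier (?C 4)" "X = Bbar_boundary 4 (Bbar_class 4 y)"
      using \<open>X \<in> Bbar_boundaries 3\<close> by (auto simp: Bbar_boundaries_def carrier_Bbar)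
    have X: "X = Bbar_class 3 (trunc_boundary 4 y)"
      using Bbar_boundary_class[of 4 y] y by simp
    have b: "trunc_boundary 4 y \<in> carrier (?C 3)"
      using trunc_boundary_in_chains[of 4 y] y(1) by simp
    show "X \<in> carrier (Bbar 3)"
      unfolding X carrier_Bbar using b by (rule imageI)
    show "\<Psi> X = \<one>\<^bsub>Phat Log\<^esub>"
      unfolding X \<Psi>_class[OF b] \<psi>_one using assms y(1) by (rule flattening_frag_boundary)
  qed
  have cycles: "\<Psi> X \<in> carrier (Bhat Log)" if X: "X \<in> Bbar_cycles 3" for X
  proof -
    obtain x where x: "x \<in> carrier (?C 3)" "X = Bbar_class 3 x"
      using X by (auto simp: Bbar_cycles_def kernel_def carrier_Bbar)
    \<comment> \<open>The boundary of the representative is a coinvariance relation, so \<mu> of it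
      is a wedge relation; subtracting it in \<open>nu_flattening_frag\<close> leaves \<nu> of the
      flattenings.\<close>
    have "Bbar_class 2 (trunc_boundary 3 x) = \<one>\<^bsub>Bbar 2\<^esub>"
      using X Bbar_boundary_class[of 3 x] x by (simp add: Bbar_cycles_def kernel_def)
    then have "mu_frag Log (trunc_boundary 3 x) \<in> wedge_rels"
      unfolding Bbar_class_eq_one_iff by (rule mu_coinv_rels)
    from subgroup_free_Abelian_groupD(4)[OF subgroup_wedge_rels nu_flattening_frag[OF x(1), of Log] this]
    have "nu_frag (flattening_frag Log x) \<in> wedge_rels"
      by simp
    then have "nu_hat (\<psi> x) = \<one>\<^bsub>Wedge2C\<^esub>"
      unfolding \<psi>_def using nu_hat_r_coset flattening_frag[OF x(1)] by blast
    then show ?thesis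
      using hom_in_carrier[OF \<psi> x(1)] by (simp add: Bhat_def kernel_def x(2) \<Psi>_class[OF x(1)])
  qed
  have cycles_subset: "Bbar_cycles 3 \<subseteq> carrier (Bbar 3)"
    by (auto simp: Bbar_cycles_def kernel_def)
  have "Bbar_boundaries 3 \<noteq> {}"
    using monoid.one_closed[OF group.is_monoid[OF group_Bbar]] by (auto simp: Bbar_boundaries_def)
  note B = subsetI[OF boundaries(1)] this boundaries(2)
  \<comment> \<open>The second passage to a quotient: \<open>\<Psi>\<close> is restricted to cycles,
    which land in the kernel of \<open>nu_hat\<close>, and divided by boundaries.\<close>
  have "induced \<Psi> \<in> hom (rel_homology 3) (Bhat Log)"
    using cycles unfolding rel_homology_def Bhat_def
    by (intro induced_hom[OF group_Bbar group_Phat \<Psi> B cycles_subset]) auto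
  \<comment> \<open>Cosets do not depend on the carrier field, so a coset formed among cycles is one
    formed in \<open>Bbar 3\<close>.\<close>
  moreover have "induced \<Psi> (homology_class 3 x) = \<Psi> x" if "x \<in> Bbar_cycles 3" for x
    using induced_r_coset[OF group_Phat \<Psi> B] cycles_subset that
    by (auto simp: homology_class_def r_coset_def)
  moreover have "\<Psi> (Bbar_class 3 (frag_of \<sigma>)) = Phat_class Log (gen_flattening Log \<sigma>)"
    if "\<sigma> \<in> trunc_simplices 3" for \<sigma>
    using \<Psi>_class[of "frag_of \<sigma>"] that by (simp add: \<psi>_def Phat_class_def)
  moreover have "\<exists>v. (\<forall>(i, j)\<in>trunc_vertices 3. v i = apply_infinity (\<sigma> (i, j))) \<and>
      is_flattening Log v (gen_flattening Log \<sigma>)" if \<sigma>: "\<sigma> \<in> trunc_simplices 3" for \<sigma>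
  proof -
    obtain v where v: "\<And>i j. i \<le> 3 \<Longrightarrow> j \<le> 3 \<Longrightarrow> i \<noteq> j \<Longrightarrow> v i = apply_infinity (\<sigma> (i, j))"
      and flat: "is_flattening Log v (gen_flattening Log \<sigma>)"
      using trunc_simplex_flattening[OF assms \<sigma>] by metis
    have "v i = apply_infinity (\<sigma> (i, j))" if "(i, j) \<in> trunc_vertices 3" for i j
      using v[of i j] that by simp
    then show ?thesis
      using flat by blast
  qed
  ultimately show ?thesis
    using \<Psi> boundaries(2) cycles by (intro conjI ballI bexI[of _ \<Psi>] bexI[of _ "induced \<Psi>"]) simp_all
qed

end
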